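(* Let $\mathbf{A}$ be a $0$-$1$ matrix of full row rank with $I$ columns and at least one $1$ in every column, let $RM_{\boldsymbol\lambda}(\mathbf{A})=\{\boldsymbol\lambda\in\mathbb{R}^I_{>0}:\log\boldsymbol\lambda=\mathbf{A}'\boldsymbol\theta\text{ for some }\boldsymbol\theta\}$, and let $K=\dim(\mathrm{Ker}(\mathbf A))$. Let $\{\boldsymbol\lambda_0^r\}\subset RM_{\boldsymbol\lambda}(\mathbf A)$ with $\|\boldsymbol\lambda_0^r\|:=\min_i\lambda^r_{0,i}\to\infty$, and let $\boldsymbol Y=\boldsymbol Y^r$ have independent components $Y_i\sim\mathrm{Poisson}(\lambda^r_{0,i})$. Let $\hat{\boldsymbol\lambda}$ be the MLE of $\boldsymbol\lambda_0^r$ under $RM_{\boldsymbol\lambda}(\mathbf A)$, $\mathscr E$ the set of data values for which it exists, and $\tilde{\boldsymbol\lambda}$ the augmented MLE. Then, as $\|\boldsymbol\lambda_0^r\|\to\infty$, each of $$\mathcal L(X^2(\boldsymbol Y,\hat{\boldsymbol\lambda})\mid\boldsymbol Y\in\mathscr E),\quad \mathcal L(B(\boldsymbol Y,\hat{\boldsymbol\lambda})\mid\boldsymbol Y\in\mathscr E),\quad \mathcal L(X^2(\boldsymbol Y,\tilde{\boldsymbol\lambda})),\quad \mathcal L(B(\boldsymbol Y,\tilde{\boldsymbol\lambda}))$$ converges to the chi-squared distribution $\chi^2_K$.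
   Context: Vector logs are componentwise. The MLE maximizes $\boldsymbol Y'\log\boldsymbol\lambda-\mathbf1'\boldsymbol\lambda$ over the model; $\mathscr E$ is the set of observations for which the maximum is attained in the model. Augmented MLE: $\tilde{\boldsymbol\lambda}=\hat{\boldsymbol\lambda}$ if $\boldsymbol Y\in\mathscr E$ and $(\mathbf1'\boldsymbol Y/I)\mathbf1$ otherwise. For $\boldsymbol u\ge\mathbf0,\boldsymbol v>\mathbf0$: $X^2(\boldsymbol u,\boldsymbol v)=\sum_i(u_i-v_i)^2/v_i$ (Pearson) and $B(\boldsymbol u,\boldsymbol v)=2\sum_i\{u_i\log(u_i/v_i)-(u_i-v_i)\}$ (Bregman), with $0\log0=0$. *)

theory Defs
  imports "HOL-Analysis.Analysis" "HOL-Probability.Probability"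
begin

definition RM :: "real^'i^'j \<Rightarrow> (real^'i) set" where
  "RM A = {lam. (\<forall>i. 0 < lam $ i) \<and> (\<exists>\<theta>::real^'j. (\<chi> i. ln (lam $ i)) = transpose A *v \<theta>)}"

definition loglik :: "('i::finite \<Rightarrow> nat) \<Rightarrow> real^'i \<Rightarrow> real" where
  "loglik Y lam = (\<Sum>i\<in>UNIV. real (Y i) * ln (lam $ i)) - (\<Sum>i\<in>UNIV. lam $ i)"

definition MLE_set :: "real^'i^'j \<Rightarrow> ('i \<Rightarrow> nat) set" where
  "MLE_set A = {Y. \<exists>lam\<in>RM A. \<forall>mu\<in>RM A. loglik Y mu \<le> loglik Y lam}"

definition MLE :: "real^'i^'j \<Rightarrow> ('i \<Rightarrow> nat) \<Rightarrow> real^'i" where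
  "MLE A Y = (SOME lam. lam \<in> RM A \<and> (\<forall>mu\<in>RM A. loglik Y mu \<le> loglik Y lam))"

definition yvec :: "('i::finite \<Rightarrow> nat) \<Rightarrow> real^'i" where
  "yvec Y = (\<chi> i. real (Y i))"

definition aug_MLE :: "real^'i^'j \<Rightarrow> ('i \<Rightarrow> nat) \<Rightarrow> real^'i" where
  "aug_MLE A Y = (if Y \<in> MLE_set A then MLE A Y
                  else (\<chi> i. (\<Sum>k\<in>UNIV. real (Y k)) / real CARD('i)))"

text \<open>Pearson statistic and Bregman (deviance) statistic; note 0 * ln 0 = 0 in Isabelle.\<close>
definition pearson :: "real^'i \<Rightarrow> real^'i \<Rightarrow> real" where
  "pearson u v = (\<Sum>i\<in>UNIV. (u $ i - v $ i)^2 / v $ i)"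

definition bregman :: "real^'i \<Rightarrow> real^'i \<Rightarrow> real" where
  "bregman u v = 2 * (\<Sum>i\<in>UNIV. u $ i * ln (u $ i / v $ i) - (u $ i - v $ i))"

definition poisson_model :: "real^'i \<Rightarrow> ('i \<Rightarrow> nat) pmf" where
  "poisson_model lam0 = Pi_pmf UNIV 0 (\<lambda>i. poisson_pmf (lam0 $ i))"

text \<open>Chi-squared distribution with K degrees of freedom: law of the sum of squares of
  K independent standard normals (K = 0 gives the point mass at 0).\<close>
definition chi_squared :: "nat \<Rightarrow> real measure" where
  "chi_squared K = distr (PiM {..<K} (\<lambda>_. density lborel std_normal_density)) borel
                      (\<lambda>x. \<Sum>k<K. (x k)^2)"

end

theory Submission
  imports Defs
begin

text \<open>
  By Skorohod's theorem the Poisson counts can be realised, coordinate by coordinate, on one product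
  space so that the standardised vector \<open>z\<^sub>i = (Y\<^sub>i - \<lambda>\<^sub>i) / \<surd>\<lambda>\<^sub>i\<close> converges pointwise to a standard
  Gaussian vector \<open>Z\<close>; the rest of the asymptotics is then deterministic. Writing the MLE as
  \<open>\<lambda>\<^sub>i exp \<eta>\<^sub>i\<close> with \<open>\<eta>\<close> in the row space of \<open>A\<close>, the score equation says that the residual
  \<open>w\<^sub>i = (Y\<^sub>i - \<lambda>\<^sub>i exp \<eta>\<^sub>i) / \<surd>\<lambda>\<^sub>i\<close> lies in the space \<open>S\<close> of all \<open>x\<close> with
  \<open>A (\<surd>\<lambda>\<^sub>i x\<^sub>i)\<^sub>i = 0\<close>, while \<open>(\<surd>\<lambda>\<^sub>i \<eta>\<^sub>i)\<^sub>i\<close> is orthogonal to \<open>S\<close> and bounded. Hence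
  \<open>w\<close> is the projection of \<open>z\<close> onto \<open>S\<close> up to a vanishing error, and both statistics equal
  \<open>\<parallel>w\<parallel>\<^sup>2\<close> up to factors tending to one. The space \<open>S\<close> moves with \<open>\<lambda>\<close>, but its dimension is
  that of the kernel of \<open>A\<close>, so by rotation invariance the squared length of the projection of \<open>Z\<close>
  is exactly chi-squared each time. No limit of \<open>S\<close> is needed.
\<close>

section \<open>Poisson central limit theorem and coupling\<close>

text \<open>The expectation is a series over \<open>n\<close>: centring contributes the constant
  factor \<open>c\<close>, the rest is the \<open>n\<close>-th power of \<open>iexp x\<close>, and
  the Poisson weights turn this into an exponential series.\<close>

lemma char_standardized_poisson:
  fixes l t :: real
  assumes l: "0 < l"
  shows "char (distr (measure_pmf (poisson_pmf l)) borel (\<lambda>n. (real n - l) / sqrt l)) t =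
    exp (of_real l * (iexp (t / sqrt l) - 1) - \<i> * of_real (t * sqrt l))"
proof -
  define x where "x = t / sqrt l"
  define c where "c = exp (- (\<i> * of_real (t * sqrt l)))"
  define f where "f = (\<lambda>n::nat. pmf (poisson_pmf l) n *\<^sub>R iexp (t * ((real n - l) / sqrt l)))"
  have f_eq: "f n = c * of_real (exp (- l)) * ((of_real l * iexp x) ^ n /\<^sub>R fact n)" for n
  proof -
    have "t * ((real n - l) / sqrt l) = of_nat n * x - t * sqrt l"
      using l by (simp add: x_def field_simps)
    then have "\<i> * of_real (t * ((real n - l) / sqrt l)) =
        - (\<i> * of_real (t * sqrt l)) + of_nat n * (\<i> * of_real x)"
      by (simp only: of_real_diff of_real_mult of_real_of_nat_eq) (simp add: algebra_simps)
    then have "iexp (t * ((real n - l) / sqrt l)) = c * iexp x ^ n"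
      unfolding c_def by (simp only: exp_add exp_of_nat_mult)
    then show ?thesis
      using l unfolding f_def by (simp only:) (simp add: scaleR_conv_of_real power_mult_distrib divide_inverse mult_ac)
  qed
  have sums: "f sums (c * of_real (exp (- l)) * exp (of_real l * iexp x))"
    unfolding f_eq by (intro sums_mult exp_converges)
  have "summable (\<lambda>n. pmf (poisson_pmf l) n)"
    using summable_mult[OF summable_exp[of l], of "exp (-l)"] l
    by (simp add: divide_inverse mult_ac)
  then have int: "integrable (count_space UNIV) f"
    by (simp add: integrable_count_space_nat_iff f_def)
  have "char (distr (measure_pmf (poisson_pmf l)) borel (\<lambda>n. (real n - l) / sqrt l)) t =
     (\<integral>n. iexp (t * ((real n - l) / sqrt l)) \<partial>measure_pmf (poisson_pmf l))"
    unfolding char_def by (subst integral_distr) auto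
  also have "\<dots> = (\<integral>n. f n \<partial>count_space UNIV)"
    unfolding f_def measure_pmf_eq_density by (subst integral_density) auto
  also have "\<dots> = c * of_real (exp (- l)) * exp (of_real l * iexp x)"
    using sums_integral_count_space_nat[OF int] sums sums_unique2 by blast
  also have "\<dots> = exp (of_real l * (iexp x - 1) - \<i> * of_real (t * sqrt l))"
    unfolding c_def by (simp add: exp_of_real[symmetric] exp_add[symmetric] algebra_simps del: exp_of_real)
  finally show ?thesis by (simp add: x_def)
qed

text \<open>By Levy's continuity theorem it suffices to follow the exponent of the characteristic
  function. Centring cancels its linear term, the quadratic term is \<open>- t^2 / 2\<close>, and
  what remains is \<open>l r\<close> times a third-order Taylor remainder at
  \<open>t / sqrt (l r)\<close>.\<close>

lemma poisson_clt:
  fixes l :: "nat \<Rightarrow> real"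
  assumes pos: "\<And>r. 0 < l r" and lim: "filterlim l at_top sequentially"
  shows "weak_conv_m
    (\<lambda>r. distr (measure_pmf (poisson_pmf (l r))) borel (\<lambda>n. (real n - l r) / sqrt (l r)))
    std_normal_distribution"
proof (rule levy_continuity)
  fix t :: real
  define d where "d = (\<lambda>r. of_real (l r) * (iexp (t / sqrt (l r)) - 1) - \<i> * of_real (t * sqrt (l r)))"
  have bound: "norm (d r - of_real (- (t^2) / 2)) \<le> \<bar>t\<bar> ^ 3 / sqrt (l r)" for r
  proof -
    define x where "x = t / sqrt (l r)"
    have lr: "l r > 0" by fact
    have tx: "t * sqrt (l r) = l r * x" "t^2 = l r * x^2"
      using lr by (auto simp: x_def power_divide field_simps)
    have "d r - of_real (- (t^2) / 2) = of_real (l r) * (iexp x - (\<Sum>k\<le>2. (\<i> * of_real x) ^ k / fact k))"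
      unfolding d_def x_def[symmetric] tx
      by (simp add: numeral_2_eq_2 algebra_simps power2_eq_square)
    also have "norm \<dots> \<le> l r * (\<bar>x\<bar> ^ 3 / fact 3)"
      using iexp_approx1[of x 2] lr by (simp add: norm_mult numeral_3_eq_3 numeral_2_eq_2)
    also have "\<dots> \<le> l r * \<bar>x\<bar> ^ 3"
      using lr by (simp add: fact_numeral)
    also have "\<dots> = \<bar>t\<bar> ^ 3 / sqrt (l r)"
    proof -
      have "sqrt (l r) ^ 3 = l r * sqrt (l r)" using lr by (simp add: power3_eq_cube)
      then show ?thesis using lr by (simp add: x_def abs_divide power_divide)
    qed
    finally show ?thesis .
  qed
  have "filterlim (\<lambda>r. sqrt (l r)) at_top sequentially"
    by (rule filterlim_compose[OF sqrt_at_top lim])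
  then have "(\<lambda>r. \<bar>t\<bar> ^ 3 / sqrt (l r)) \<longlonglongrightarrow> 0"
    by (intro real_tendsto_divide_at_top[OF tendsto_const])
  then have "(\<lambda>r. d r - of_real (- (t^2) / 2)) \<longlonglongrightarrow> 0"
    by (rule Lim_null_comparison[rotated]) (intro always_eventually allI bound)
  then have "d \<longlonglongrightarrow> of_real (- (t^2) / 2)"
    by (rule LIM_zero_cancel)
  then have "(\<lambda>r. exp (d r)) \<longlonglongrightarrow> exp (of_real (- (t^2) / 2))"
    by (rule tendsto_exp)
  then show "(\<lambda>r. char (distr (measure_pmf (poisson_pmf (l r))) borel
      (\<lambda>n. (real n - l r) / sqrt (l r))) t) \<longlonglongrightarrow> char std_normal_distribution t"
    by (simp add: char_standardized_poisson pos d_def char_std_normal_distribution exp_of_real[symmetric]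
        del: exp_of_real)
next
  show "real_distribution (distr (measure_pmf (poisson_pmf (l r))) borel
      (\<lambda>n. (real n - l r) / sqrt (l r)))" for r
    by (rule prob_space.real_distribution_distr) (auto intro: measure_pmf.prob_space_axioms)
qed (rule real_dist_normal_dist)

text \<open>Skorohod's theorem supplies real variables, and rounding recovers counts from them. The
  law stays exactly Poisson because \<open>g r\<close> inverts the standardisation
  \<open>h r\<close>.\<close>

lemma poisson_coupling:
  fixes l :: "nat \<Rightarrow> real"
  assumes pos: "\<And>r. 0 < l r" and lim: "filterlim l at_top sequentially"
  shows "\<exists>(\<Omega> :: real measure) (N :: nat \<Rightarrow> real \<Rightarrow> nat) (Z :: real \<Rightarrow> real).
    prob_space \<Omega> \<and> (\<forall>r. N r \<in> measurable \<Omega> (count_space UNIV)) \<and>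
    (\<forall>r. distr \<Omega> (count_space UNIV) (N r) = measure_pmf (poisson_pmf (l r))) \<and>
    Z \<in> borel_measurable \<Omega> \<and> distr \<Omega> borel Z = std_normal_distribution \<and>
    (\<forall>x\<in>space \<Omega>. (\<lambda>r. (real (N r x) - l r) / sqrt (l r)) \<longlonglongrightarrow> Z x)"
proof -
  define h where "h = (\<lambda>r (n::nat). (real n - l r) / sqrt (l r))"
  \<comment> \<open>Rounding recovers integer values even on the null set where Skorohod's variables leave the lattice.\<close>
  define g where "g = (\<lambda>r z. nat \<lfloor>l r + sqrt (l r) * z + 1 / 2\<rfloor>)"
  have gh: "g r (h r n) = n" for r n
    using pos[of r] by (simp add: g_def h_def floor_eq_iff nat_eq_iff2 less_imp_neq[symmetric])
  have g_meas [measurable]: "g r \<in> measurable borel (count_space UNIV)" for r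
    unfolding g_def by measurable
  have dist: "real_distribution (distr (measure_pmf (poisson_pmf (l r))) borel (h r))" for r
    by (rule prob_space.real_distribution_distr) (auto intro: measure_pmf.prob_space_axioms)
  obtain \<Omega> :: "real measure" and Q Z where \<Omega>: "prob_space \<Omega>"
    and Q [measurable]: "\<And>r. Q r \<in> borel_measurable \<Omega>"
    and distr_Q: "\<And>r. distr \<Omega> borel (Q r) = distr (measure_pmf (poisson_pmf (l r))) borel (h r)"
    and Z: "Z \<in> borel_measurable \<Omega>" "distr \<Omega> borel Z = std_normal_distribution"
    and conv: "\<And>x. x \<in> space \<Omega> \<Longrightarrow> (\<lambda>r. Q r x) \<longlonglongrightarrow> Z x"
    using Skorohod[OF dist real_dist_normal_dist, unfolded h_def, OF poisson_clt[OF pos lim]]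
    unfolding h_def by force
  define N where "N = (\<lambda>r x. g r (Q r x))"
  have distr_N: "distr \<Omega> (count_space UNIV) (N r) = measure_pmf (poisson_pmf (l r))" for r
  proof -
    have "distr \<Omega> (count_space UNIV) (N r) = distr (distr \<Omega> borel (Q r)) (count_space UNIV) (g r)"
      unfolding N_def by (subst distr_distr) (auto simp: comp_def)
    also have "\<dots> = distr (measure_pmf (poisson_pmf (l r))) (count_space UNIV) (\<lambda>n. g r (h r n))"
      unfolding distr_Q by (subst distr_distr) (auto simp: comp_def)
    also have "\<dots> = distr (measure_pmf (poisson_pmf (l r))) (measure_pmf (poisson_pmf (l r))) (\<lambda>n. n)"
      unfolding gh by (rule distr_cong) auto
    finally show ?thesis by (simp add: distr_id)
  qed
  have sqrt_lim: "filterlim (\<lambda>r. sqrt (l r)) at_top sequentially"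
    by (rule filterlim_compose[OF sqrt_at_top lim])
  have conv': "(\<lambda>r. h r (N r x)) \<longlonglongrightarrow> Z x" if x: "x \<in> space \<Omega>" for x
  proof -
    \<comment> \<open>Once this sum is nonnegative, \<open>nat\<close> no longer truncates, and
      rounding moves the standardised value by at most \<open>1 / sqrt (l r)\<close>.\<close>
    have "filterlim (\<lambda>r. sqrt (l r) + Q r x) at_top sequentially"
      using filterlim_tendsto_add_at_top[OF conv[OF x] sqrt_lim] by (simp add: add.commute)
    then have "eventually (\<lambda>r. 0 \<le> sqrt (l r) + Q r x) sequentially"
      by (auto simp: filterlim_at_top)
    then have "eventually (\<lambda>r. norm (h r (N r x) - Q r x) \<le> 1 / sqrt (l r)) sequentially"
    proof eventually_elim
      case (elim r)
      have "0 \<le> sqrt (l r) * (sqrt (l r) + Q r x)" using elim pos[of r] by simp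
      then have "0 \<le> l r + sqrt (l r) * Q r x" using pos[of r] by (simp add: distrib_left)
      then have "real (N r x) = of_int \<lfloor>l r + sqrt (l r) * Q r x + 1 / 2\<rfloor>"
        unfolding N_def g_def by (subst of_nat_nat) auto
      then have "\<bar>real (N r x) - (l r + sqrt (l r) * Q r x)\<bar> \<le> 1" by linarith
      moreover have "h r (N r x) - Q r x = (real (N r x) - (l r + sqrt (l r) * Q r x)) / sqrt (l r)"
        using pos[of r] by (simp add: h_def field_simps)
      ultimately show ?case
        using pos[of r] by (simp add: abs_divide divide_right_mono)
    qed
    moreover have "(\<lambda>r. 1 / sqrt (l r)) \<longlonglongrightarrow> 0"
      by (intro real_tendsto_divide_at_top[OF tendsto_const] sqrt_lim)
    ultimately have "(\<lambda>r. h r (N r x) - Q r x) \<longlonglongrightarrow> 0"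
      by (rule Lim_null_comparison)
    from tendsto_add[OF this conv[OF x]] show ?thesis by simp
  qed
  show ?thesis
    using \<Omega> distr_N Z conv' by (intro exI[of _ \<Omega>] exI[of _ N] exI[of _ Z]) (auto simp: h_def N_def)
qed

text \<open>Unlike in Slutsky's theorem, the approximating variables need not converge: it suffices that
  they all have the limit law.\<close>

lemma weak_conv_m_of_vanishing_difference:
  assumes M: "prob_space M"
    and X [measurable]: "\<And>r. X r \<in> borel_measurable M"
    and T [measurable]: "\<And>r. T r \<in> borel_measurable M"
    and distr_T: "\<And>r. distr M borel (T r) = \<mu>"
    and conv: "\<And>\<omega>. \<omega> \<in> space M \<Longrightarrow> (\<lambda>r. X r \<omega> - T r \<omega>) \<longlonglongrightarrow> (0::real)"
  shows "weak_conv_m (\<lambda>r. distr M borel (X r)) \<mu>"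
proof (rule levy_continuity)
  interpret prob_space M by fact
  show "real_distribution (distr M borel (X r))" for r
    by (rule real_distribution_distr) simp
  show "real_distribution \<mu>"
    unfolding distr_T[of 0, symmetric] by (rule real_distribution_distr) simp
  fix t :: real
  have bdd: "integrable M (\<lambda>\<omega>. iexp (t * W \<omega>))" if [measurable]: "W \<in> borel_measurable M" for W
    by (rule integrable_const_bound[where B = 1]) auto
  have char_eq: "char (distr M borel W) t = (\<integral>\<omega>. iexp (t * W \<omega>) \<partial>M)"
    if [measurable]: "W \<in> borel_measurable M" for W
    unfolding char_def by (subst integral_distr) auto
  have "(\<lambda>r. \<integral>\<omega>. (iexp (t * X r \<omega>) - iexp (t * T r \<omega>)) \<partial>M) \<longlonglongrightarrow> (\<integral>\<omega>. 0 \<partial>M)"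
  proof (rule integral_dominated_convergence[where w = "\<lambda>_. 2"])
    show "AE \<omega> in M. (\<lambda>r. iexp (t * X r \<omega>) - iexp (t * T r \<omega>)) \<longlonglongrightarrow> 0"
    proof (rule AE_I2)
      fix \<omega> assume \<omega>: "\<omega> \<in> space M"
      have "(\<lambda>r. iexp (t * (X r \<omega> - T r \<omega>)) - 1) \<longlonglongrightarrow> iexp (t * 0) - 1"
        by (intro tendsto_intros conv \<omega>)
      then have lim: "(\<lambda>r. norm (iexp (t * (X r \<omega> - T r \<omega>)) - 1)) \<longlonglongrightarrow> 0"
        by (simp add: tendsto_norm_zero)
      \<comment> \<open>Factoring out \<open>iexp (t * T r \<omega>)\<close>, which has modulus one,
        removes \<open>T r\<close> itself and leaves only the vanishing difference.\<close>
      have eq: "norm (iexp (t * (X r \<omega> - T r \<omega>)) - 1) = norm (iexp (t * X r \<omega>) - iexp (t * T r \<omega>))" for r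
      proof -
        have "iexp (t * X r \<omega>) - iexp (t * T r \<omega>) = iexp (t * T r \<omega>) * (iexp (t * (X r \<omega> - T r \<omega>)) - 1)"
          by (simp add: algebra_simps flip: exp_add)
        then show ?thesis by (simp add: norm_mult)
      qed
      show "(\<lambda>r. iexp (t * X r \<omega>) - iexp (t * T r \<omega>)) \<longlonglongrightarrow> 0"
        by (rule tendsto_norm_zero_cancel) (rule lim[unfolded eq])
    qed
    show "AE \<omega> in M. norm (iexp (t * X r \<omega>) - iexp (t * T r \<omega>)) \<le> 2" for r
      by (intro AE_I2 order_trans[OF norm_triangle_ineq4]) auto
  qed auto
  moreover have "(\<integral>\<omega>. (iexp (t * X r \<omega>) - iexp (t * T r \<omega>)) \<partial>M) =
      char (distr M borel (X r)) t - char \<mu> t" for r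
    unfolding char_eq[OF X] distr_T[of r, symmetric] char_eq[OF T]
    by (rule Bochner_Integration.integral_diff[OF bdd[OF X] bdd[OF T]])
  ultimately have "(\<lambda>r. char (distr M borel (X r)) t - char \<mu> t) \<longlonglongrightarrow> 0"
    by simp
  then show "(\<lambda>r. char (distr M borel (X r)) t) \<longlonglongrightarrow> char \<mu> t"
    by (rule LIM_zero_cancel)
qed

section \<open>Projections of a standard Gaussian vector\<close>

text \<open>This is the Fubini argument for uniqueness of Haar measure. The double integral of
  \<open>indicator B x * indicator A y\<close> is sheared alternately in \<open>y\<close> and in
  \<open>x\<close>, using the invariance of both measures, until the two sets have changed places.
  The product form avoids dividing by measures that may be zero or infinite.\<close>

lemma translation_invariant_proportional_lborel:
  fixes M :: "'a::euclidean_space measure"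
  assumes sets_M [measurable_cong]: "sets M = sets borel" and sf: "sigma_finite_measure M"
    and inv: "\<And>a. distr M borel (\<lambda>x. x + a) = M"
    and B [measurable]: "B \<in> sets borel" and sym: "\<And>x. - x \<in> B \<longleftrightarrow> x \<in> B"
    and A [measurable]: "A \<in> sets borel"
  shows "emeasure M B * emeasure lborel A = emeasure lborel B * emeasure M A"
proof -
  interpret M: sigma_finite_measure M by fact
  interpret pair_sigma_finite M "lborel :: 'a measure" ..
  have shift_lborel: "(\<integral>\<^sup>+x. g x \<partial>lborel) = (\<integral>\<^sup>+x. g (x + a) \<partial>lborel)"
    if [measurable]: "g \<in> borel_measurable borel" for g and a :: 'a
  proof -
    have "(\<integral>\<^sup>+x. g x \<partial>lborel) = (\<integral>\<^sup>+x. g x \<partial>distr lborel borel ((+) a))"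
      by (simp add: lborel_distr_plus)
    also have "\<dots> = (\<integral>\<^sup>+x. g (x + a) \<partial>lborel)"
      by (subst nn_integral_distr) (auto simp: add.commute)
    finally show ?thesis .
  qed
  have shift_M: "(\<integral>\<^sup>+x. g x \<partial>M) = (\<integral>\<^sup>+x. g (x + a) \<partial>M)"
    if [measurable]: "g \<in> borel_measurable borel" for g and a :: 'a
    by (subst inv[symmetric, of a], subst nn_integral_distr) auto
  have "emeasure M B * emeasure lborel A =
      (\<integral>\<^sup>+x. \<integral>\<^sup>+y. indicator B x * indicator A y \<partial>lborel \<partial>M)"
    by (simp add: nn_integral_cmult nn_integral_multc sets_M)
  also have "\<dots> = (\<integral>\<^sup>+x. \<integral>\<^sup>+y. indicator B x * indicator A (y + x) \<partial>lborel \<partial>M)"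
    by (intro nn_integral_cong shift_lborel) auto
  also have "\<dots> = (\<integral>\<^sup>+y. \<integral>\<^sup>+x. indicator B x * indicator A (y + x) \<partial>M \<partial>lborel)"
    by (rule Fubini'[symmetric]) auto
  also have "\<dots> = (\<integral>\<^sup>+y. \<integral>\<^sup>+x. indicator B (x + - y) * indicator A (y + (x + - y)) \<partial>M \<partial>lborel)"
    by (intro nn_integral_cong shift_M) auto
  \<comment> \<open>Symmetry of \<open>B\<close> replaces \<open>x - y\<close> by
    \<open>y - x\<close>, which a translation in \<open>y\<close> then removes.\<close>
  also have "\<dots> = (\<integral>\<^sup>+y. \<integral>\<^sup>+x. indicator A x * indicator B (y + - x) \<partial>M \<partial>lborel)"
    using sym[of "x - y" for x y] by (intro nn_integral_cong) (auto simp: indicator_def)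
  also have "\<dots> = (\<integral>\<^sup>+x. \<integral>\<^sup>+y. indicator A x * indicator B (y + - x) \<partial>lborel \<partial>M)"
    by (rule Fubini') auto
  also have "\<dots> = (\<integral>\<^sup>+x. \<integral>\<^sup>+y. indicator A x * indicator B y \<partial>lborel \<partial>M)"
    by (intro nn_integral_cong shift_lborel[symmetric]) auto
  also have "\<dots> = emeasure lborel B * emeasure M A"
    by (simp add: nn_integral_cmult nn_integral_multc sets_M mult.commute)
  finally show ?thesis .
qed

text \<open>The image measure is translation invariant, hence a multiple of Lebesgue measure; the unit
  ball shows that the factor is one.\<close>

lemma distr_lborel_orthogonal:
  fixes f :: "'a::euclidean_space \<Rightarrow> 'a"
  assumes f: "orthogonal_transformation f"
  shows "distr lborel borel f = lborel"
proof -
  let ?M = "distr lborel borel f" and ?B = "ball 0 1 :: 'a set"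
  have lin: "linear f" and norm_f: "\<And>x. norm (f x) = norm x"
    using f by (auto simp: orthogonal_transformation)
  have f_meas [measurable]: "f \<in> borel_measurable borel"
    using lin by (intro borel_measurable_continuous_onI linear_continuous_on)
      (simp add: linear_conv_bounded_linear)
  have preim: "emeasure ?M (ball 0 r) = emeasure lborel (ball (0::'a) r)" for r
  proof -
    have "f -` ball 0 r = ball 0 r" by (auto simp: norm_f)
    then show ?thesis by (simp add: emeasure_distr)
  qed
  have fin: "emeasure lborel (ball (0::'a) r) \<noteq> \<top>" for r
    using emeasure_bounded_finite[OF bounded_ball] by (metis less_irrefl infinity_ennreal_def)
  have "sigma_finite_measure ?M"
  proof
    show "\<exists>A. countable A \<and> A \<subseteq> sets ?M \<and> \<Union> A = space ?M \<and> (\<forall>a\<in>A. emeasure ?M a \<noteq> \<infinity>)"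
    proof (intro exI conjI ballI)
      show "\<Union> (range (\<lambda>n. ball (0::'a) (real n))) = space ?M"
        using reals_Archimedean2 by (force simp: dist_norm)
      show "emeasure ?M a \<noteq> \<infinity>" if "a \<in> range (\<lambda>n. ball (0::'a) (real n))" for a
        using that fin by (auto simp: preim)
    qed auto
  qed
  \<comment> \<open>By linearity, translating by \<open>a\<close> after \<open>f\<close> amounts to
    translating by a preimage of \<open>a\<close> first, and Lebesgue measure absorbs that
    translation.\<close>
  moreover have "distr ?M borel (\<lambda>x. x + a) = ?M" for a
  proof -
    obtain c where c: "f c = a"
      using orthogonal_transformation_surj[OF f] by (metis surjD)
    have "distr ?M borel (\<lambda>x. x + a) = distr lborel borel (\<lambda>x. f (c + x))"
      by (subst distr_distr) (auto simp: comp_def linear_add[OF lin] c add.commute)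
    also have "\<dots> = distr (distr lborel borel ((+) c)) borel f"
      by (subst distr_distr) (auto simp: comp_def)
    finally show ?thesis by (simp add: lborel_distr_plus)
  qed
  ultimately have *: "emeasure ?M ?B * emeasure lborel A = emeasure lborel ?B * emeasure ?M A"
    if "A \<in> sets borel" for A
    using that by (intro translation_invariant_proportional_lborel) auto
  \<comment> \<open>The ball has positive finite measure, equal under both measures, so the
    proportionality relation cancels to an equality.\<close>
  have "?B \<notin> null_sets lborel"
    using open_not_negligible[of ?B] by (auto simp: negligible_iff_null_sets dest: null_sets_completionI)
  then have "emeasure lborel ?B \<noteq> 0" by (auto simp: null_sets_def)
  with fin have "emeasure lborel A = emeasure ?M A" if "A \<in> sets borel" for A
    using *[OF that] unfolding preim by (simp add: ennreal_mult_cancel_left)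
  then show ?thesis by (intro measure_eqI) auto
qed

section \<open>Product measures and the density of the standard Gaussian vector\<close>

lemma distr_PiM_componentwise:
  fixes M :: "'i::finite \<Rightarrow> 'a measure"
  assumes M: "\<And>i. prob_space (M i)" and f [measurable]: "\<And>i. f i \<in> measurable (M i) (N i)"
  shows "distr (PiM UNIV M) (PiM UNIV N) (\<lambda>\<omega> i. f i (\<omega> i)) = PiM UNIV (\<lambda>i. distr (M i) (N i) (f i))"
proof -
  interpret M: product_prob_space M UNIV
    by (intro product_prob_spaceI M)
  interpret D: product_prob_space "\<lambda>i. distr (M i) (N i) (f i)" UNIV
    by (intro product_prob_spaceI prob_space.prob_space_distr M f)
  have meas: "(\<lambda>\<omega> i. f i (\<omega> i)) \<in> measurable (PiM UNIV M) (PiM UNIV N)"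
    by (rule measurable_PiM_single') (auto simp: space_PiM PiE_iff intro!: measurable_space[OF f])
  show ?thesis
  proof (rule D.PiM_eqI)
    show "sets (distr (PiM UNIV M) (PiM UNIV N) (\<lambda>\<omega> i. f i (\<omega> i))) = sets (PiM UNIV (\<lambda>i. distr (M i) (N i) (f i)))"
      by (simp cong: sets_PiM_cong)
    fix A assume A: "\<And>i. i \<in> UNIV \<Longrightarrow> A i \<in> sets (distr (M i) (N i) (f i))"
    then have A' [measurable]: "\<And>i. A i \<in> sets (N i)" by simp
    have "emeasure (distr (PiM UNIV M) (PiM UNIV N) (\<lambda>\<omega> i. f i (\<omega> i))) (Pi\<^sub>E UNIV A) =
        emeasure (PiM UNIV M) ((\<lambda>\<omega> i. f i (\<omega> i)) -` Pi\<^sub>E UNIV A \<inter> space (PiM UNIV M))"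
      by (rule emeasure_distr[OF meas]) (auto intro!: sets_PiM_I_finite)
    also have "(\<lambda>\<omega> i. f i (\<omega> i)) -` Pi\<^sub>E UNIV A \<inter> space (PiM UNIV M) =
        Pi\<^sub>E UNIV (\<lambda>i. f i -` A i \<inter> space (M i))"
      by (auto simp: space_PiM PiE_iff)
    also have "emeasure (PiM UNIV M) \<dots> = (\<Prod>i\<in>UNIV. emeasure (M i) (f i -` A i \<inter> space (M i)))"
      by (rule M.emeasure_PiM) auto
    also have "\<dots> = (\<Prod>i\<in>UNIV. emeasure (distr (M i) (N i) (f i)) (A i))"
      by (intro prod.cong refl emeasure_distr[symmetric]) auto
    finally show "emeasure (distr (PiM UNIV M) (PiM UNIV N) (\<lambda>\<omega> i. f i (\<omega> i))) (Pi\<^sub>E UNIV A) =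
        (\<Prod>i\<in>UNIV. emeasure (distr (M i) (N i) (f i)) (A i))" .
  qed simp
qed

lemma measurable_vec_lambda [measurable]:
  assumes [measurable]: "\<And>i. f i \<in> borel_measurable M"
  shows "(\<lambda>x. (\<chi> i. f i x) :: real^'i) \<in> borel_measurable M"
proof (rule borel_measurable_euclidean_space[THEN iffD2], intro ballI)
  fix b :: "real^'i" assume "b \<in> Basis"
  then obtain i where "b = axis i 1" by (auto simp: Basis_vec_def)
  then show "(\<lambda>x. (\<chi> i. f i x) \<bullet> b) \<in> borel_measurable M"
    by (simp add: inner_axis)
qed

text \<open>Rotation invariance is visible on densities, not on product measures. The proof runs
  backwards: the coordinates of the density measure have the product law, as is checked on boxes,
  and reassembling the vector undoes the passage to coordinates.\<close>

lemma PiM_std_normal_eq_density: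
  "distr (PiM UNIV (\<lambda>_::'i::finite. std_normal_distribution)) borel (\<lambda>x. \<chi> i. x i) =
   density lborel (\<lambda>z::real^'i. ennreal (\<Prod>i\<in>UNIV. std_normal_density (z $ i)))"
  (is "distr ?P borel _ = ?G")
proof -
  interpret D: product_prob_space "\<lambda>_::'i. std_normal_distribution" UNIV
    by (intro product_prob_spaceI) (simp add: prob_space_normal_density)
  have nth_meas [measurable]: "(\<lambda>z::real^'i. z $ i) \<in> borel_measurable borel" for i
    by (intro borel_measurable_continuous_onI continuous_intros)
  have meas [measurable]: "vec_nth \<in> measurable borel ?P"
    by (rule measurable_PiM_single') (auto simp: space_PiM)
  have "distr ?G ?P vec_nth = ?P"
  proof (rule D.PiM_eqI)
    fix X :: "'i \<Rightarrow> real set" assume "\<And>i. i \<in> UNIV \<Longrightarrow> X i \<in> sets std_normal_distribution"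
    then have X [measurable]: "\<And>i. X i \<in> sets borel" by simp
    define ax where "ax = (\<lambda>i::'i. axis i (1::real))"
    have inj: "inj ax" by (auto simp: ax_def inj_on_def axis_eq_axis)
    have Basis: "Basis = range ax" by (auto simp: ax_def Basis_vec_def)
    define g where "g = (\<lambda>i x. ennreal (std_normal_density x) * indicator (X i) x)"
    have g_meas [measurable]: "g i \<in> borel_measurable borel" for i
      unfolding g_def by measurable
    have "emeasure (distr ?G ?P vec_nth) (Pi\<^sub>E UNIV X) = emeasure ?G (vec_nth -` Pi\<^sub>E UNIV X)"
      by (subst emeasure_distr) (auto intro!: sets_PiM_I_finite)
    also have "\<dots> = (\<integral>\<^sup>+z. ennreal (\<Prod>i\<in>UNIV. std_normal_density (z $ i)) * indicator (vec_nth -` Pi\<^sub>E UNIV X) z \<partial>lborel)"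
    proof (rule emeasure_density)
      have "vec_nth -` Pi\<^sub>E UNIV X \<inter> space borel \<in> sets (borel :: (real^'i) measure)"
        by (rule measurable_sets[OF meas]) (auto intro!: sets_PiM_I_finite)
      then show "vec_nth -` Pi\<^sub>E UNIV X \<in> sets (lborel :: (real^'i) measure)" by simp
    qed measurable
    also have "\<dots> = (\<integral>\<^sup>+z. (\<Prod>i\<in>UNIV. g i (z $ i)) \<partial>lborel)"
    proof (intro nn_integral_cong)
      fix z :: "real^'i"
      have "indicator (vec_nth -` Pi\<^sub>E UNIV X) z = (\<Prod>i\<in>UNIV. indicator (X i) (z $ i) :: ennreal)"
        by (auto simp: indicator_def PiE_iff prod_ennreal intro!: prod.neutral[symmetric])
      then show "ennreal (\<Prod>i\<in>UNIV. std_normal_density (z $ i)) * indicator (vec_nth -` Pi\<^sub>E UNIV X) z =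
          (\<Prod>i\<in>UNIV. g i (z $ i))"
        by (simp add: g_def prod.distrib prod_ennreal)
    qed
    \<comment> \<open>Lebesgue integrals factor over \<open>Basis\<close>; \<open>ax\<close> carries
      the product from the index type to the axis vectors and back.\<close>
    also have "\<dots> = (\<integral>\<^sup>+z. (\<Prod>b\<in>Basis. g (inv ax b) (z \<bullet> b)) \<partial>lborel)"
      unfolding Basis by (subst prod.reindex[OF inj]) (simp add: inv_f_f[OF inj] inner_axis, simp add: ax_def inner_axis)
    also have "\<dots> = (\<Prod>b\<in>Basis. \<integral>\<^sup>+x. g (inv ax b) x \<partial>lborel)"
      by (rule nn_integral_lborel_prod) auto
    also have "\<dots> = (\<Prod>i\<in>UNIV. \<integral>\<^sup>+x. g i x \<partial>lborel)"
      unfolding Basis by (subst prod.reindex[OF inj]) (simp add: inv_f_f[OF inj])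
    also have "\<dots> = (\<Prod>i\<in>UNIV. emeasure std_normal_distribution (X i))"
      unfolding g_def by (intro prod.cong refl emeasure_density[symmetric]) auto
    finally show "emeasure (distr ?G ?P vec_nth) (Pi\<^sub>E UNIV X) = (\<Prod>i\<in>UNIV. emeasure std_normal_distribution (X i))" .
  qed auto
  then have "distr ?P borel (\<lambda>x. \<chi> i. x i) = distr (distr ?G ?P vec_nth) borel (\<lambda>x. \<chi> i. x i)"
    by simp
  also have "\<dots> = distr ?G borel (\<lambda>z. z)"
    by (subst distr_distr) (auto simp: comp_def)
  also have "\<dots> = distr ?G ?G (\<lambda>z. z)" by (rule distr_cong) auto
  finally show ?thesis by (simp add: distr_id)
qed

text \<open>The exponents add up to the squared norm, so the density is constant on spheres; this is
  the source of rotation invariance.\<close>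

lemma prod_std_normal_density_eq_norm:
  fixes z :: "real^'i"
  shows "(\<Prod>i\<in>UNIV. std_normal_density (z $ i)) = (1 / sqrt (2 * pi)) ^ CARD('i) * exp (- (norm z)\<^sup>2 / 2)"
proof -
  have "(\<Prod>i\<in>UNIV. exp (- (z $ i)\<^sup>2 / 2)) = exp (\<Sum>i\<in>UNIV. - (z $ i)\<^sup>2 / 2)"
    by (simp add: exp_sum)
  also have "(\<Sum>i\<in>UNIV. - (z $ i)\<^sup>2 / 2) = - (norm z)\<^sup>2 / 2"
    by (simp add: norm_vec_def L2_set_def sum_nonneg sum_divide_distrib sum_negf)
  finally show ?thesis
    by (simp add: std_normal_density_def prod.distrib prod_dividef power_one_over)
qed

text \<open>An isometry fixes the density, a function of the norm alone, and it fixes Lebesgue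
  measure.\<close>

lemma std_normal_vector_orthogonal_invariant:
  fixes f :: "real^'i \<Rightarrow> real^'i"
  assumes f: "orthogonal_transformation f"
  defines "G \<equiv> distr (PiM UNIV (\<lambda>_::'i. std_normal_distribution)) borel (\<lambda>x. \<chi> i. x i)"
  shows "distr G borel f = G"
proof -
  define \<phi> where "\<phi> = (\<lambda>z::real^'i. ennreal ((1 / sqrt (2 * pi)) ^ CARD('i) * exp (- (norm z)\<^sup>2 / 2)))"
  have G: "G = density lborel \<phi>"
    unfolding G_def PiM_std_normal_eq_density prod_std_normal_density_eq_norm \<phi>_def ..
  have \<phi>_meas [measurable]: "\<phi> \<in> borel_measurable borel" unfolding \<phi>_def by measurable
  have lin: "linear f" and norm_f: "\<And>x. norm (f x) = norm x"
    using f by (auto simp: orthogonal_transformation)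
  have f_meas [measurable]: "f \<in> borel_measurable borel"
    using lin by (intro borel_measurable_continuous_onI linear_continuous_on)
      (simp add: linear_conv_bounded_linear)
  have "distr G borel f = distr (density lborel (\<lambda>z. \<phi> (f z))) borel f"
    by (simp add: G \<phi>_def norm_f)
  also have "\<dots> = density (distr lborel borel f) \<phi>"
    by (rule density_distr[symmetric]) auto
  finally show ?thesis by (simp add: distr_lborel_orthogonal[OF f] G)
qed

text \<open>An orthonormal basis \<open>C\<close> of the orthogonal complement completes
  \<open>B\<close> to an orthonormal basis \<open>D\<close> of the whole space. Sending the
  coordinate axes to \<open>D\<close> is an isometry, under which inner products with
  \<open>B\<close> become coordinates, listed by \<open>h\<close>.\<close>

lemma orthonormal_imp_isometry:
  fixes B :: "(real^'i) set"
  assumes orth: "pairwise orthogonal B" and unit: "\<And>b. b \<in> B \<Longrightarrow> norm b = 1"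
  obtains f :: "real^'i \<Rightarrow> real^'i" and h :: "nat \<Rightarrow> 'i" where "orthogonal_transformation f" "inj_on h {..<card B}"
    "\<And>z::real^'i. (\<Sum>b\<in>B. (b \<bullet> f z)\<^sup>2) = (\<Sum>k<card B. (z $ h k)\<^sup>2)"
proof -
  define C0 where "C0 = {y \<in> UNIV. \<forall>x\<in>span B. orthogonal x y}"
  have "subspace C0"
    unfolding C0_def by (auto intro!: subspaceI simp: orthogonal_clauses)
  then obtain C where C: "C \<subseteq> C0" "pairwise orthogonal C" "\<And>x. x \<in> C \<Longrightarrow> norm x = 1"
      "independent C" "card C = dim C0"
    by (rule orthonormal_basis_subspace) blast
  have "0 \<notin> B" using unit by force
  then have indB: "independent B" by (rule pairwise_orthogonal_independent[OF orth])
  then have fin: "finite B" "finite C"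
    using C(4) by (auto intro: independent_imp_finite)
  have "dim C0 + dim (span B) = dim (UNIV :: (real^'i) set)"
    unfolding C0_def by (rule dim_subspace_orthogonal_to_vectors) auto
  \<comment> \<open>With disjointness, this count gives \<open>D\<close> as many members as there
    are coordinates, hence the indexing \<open>p\<close>.\<close>
  then have cards: "card C + card B = CARD('i)"
    using C(5) dim_eq_card_independent[OF indB] by simp
  have BC: "orthogonal b c" if "b \<in> B" "c \<in> C" for b c
    using C(1) that by (auto simp: C0_def span_base)
  then have CB: "orthogonal c b" if "b \<in> B" "c \<in> C" for b c
    using that by (simp add: orthogonal_commute)
  have disj: "B \<inter> C = {}"
  proof (rule ccontr)
    assume "B \<inter> C \<noteq> {}"
    then obtain x where "x \<in> B" "x \<in> C" by blast
    with BC[of x x] unit[of x] show False by (simp add: orthogonal_self)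
  qed
  define D where "D = B \<union> C"
  have D: "pairwise orthogonal D" "\<And>x. x \<in> D \<Longrightarrow> norm x = 1" "finite D" "card D = CARD('i)"
    using orth C unit fin cards BC CB disj
    by (auto simp: D_def pairwise_def card_Un_disjoint)
  then obtain p where p: "bij_betw p (UNIV :: 'i set) D"
    by (metis finite_same_card_bij finite_class.finite_UNIV)
  have p_orth: "p i \<bullet> p j = (if i = j then 1 else 0)" for i j
  proof -
    have "p i \<in> D" "p j \<in> D" using p by (auto simp: bij_betw_def)
    moreover have "p i \<noteq> p j" if "i \<noteq> j" using p that by (auto simp: bij_betw_def inj_on_def)
    ultimately show ?thesis
      using D(1,2) by (auto simp: pairwise_def orthogonal_def dot_square_norm)
  qed
  define f where "f = (\<lambda>z::real^'i. \<Sum>i\<in>UNIV. (z $ i) *\<^sub>R p i)"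
  have p_f: "p j \<bullet> f z = z $ j" for j z
    by (simp add: f_def inner_sum_right p_orth if_distrib sum.delta cong: if_cong)
  have lin: "linear f"
    unfolding f_def by (rule linearI) (simp_all add: scaleR_add_left sum.distrib scaleR_sum_right)
  moreover have "norm (f z) = norm z" for z
  proof -
    have "f z \<bullet> f z = (\<Sum>i\<in>UNIV. z $ i * (p i \<bullet> f z))"
      by (subst (1) f_def) (simp add: inner_sum_left)
    also have "\<dots> = z \<bullet> z" unfolding p_f by (simp add: inner_vec_def)
    finally show ?thesis by (simp add: norm_eq_sqrt_inner)
  qed
  ultimately have "orthogonal_transformation f" by (simp add: orthogonal_transformation)
  moreover
  obtain e where e: "bij_betw e {..<card B} B"
    using ex_bij_betw_nat_finite[OF fin(1)] by (auto simp: atLeast0LessThan)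
  define h where "h = (\<lambda>k. inv_into UNIV p (e k))"
  have ph: "p (h k) = e k" if "k < card B" for k
  proof -
    have "e k \<in> D" using e that by (auto simp: bij_betw_def D_def)
    then show ?thesis using p by (auto simp: h_def bij_betw_def intro!: f_inv_into_f)
  qed
  have "inj_on h {..<card B}"
  proof (rule inj_onI)
    fix k l assume "k \<in> {..<card B}" "l \<in> {..<card B}" "h k = h l"
    then show "k = l" using e ph[of k] ph[of l] by (auto simp: bij_betw_def dest: inj_onD)
  qed
  moreover have "(\<Sum>b\<in>B. (b \<bullet> f z)\<^sup>2) = (\<Sum>k<card B. (z $ h k)\<^sup>2)" for z
    by (subst sum.reindex_bij_betw[OF e, symmetric]) (simp add: ph[symmetric] p_f)
  ultimately show ?thesis using that by blast
qed

text \<open>Rotation invariance trades the inner products with \<open>B\<close> for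
  \<open>card B\<close> coordinates. These are distinct because \<open>h\<close> is injective, hence
  again independent standard normals.\<close>

lemma distr_orthonormal_sum_squares:
  fixes B :: "(real^'i) set"
  assumes orth: "pairwise orthogonal B" and unit: "\<And>b. b \<in> B \<Longrightarrow> norm b = 1"
  shows "distr (PiM UNIV (\<lambda>_::'i. std_normal_distribution)) borel
      (\<lambda>x. \<Sum>b\<in>B. (b \<bullet> (\<chi> i. x i))\<^sup>2) = chi_squared (card B)"
proof -
  let ?P = "PiM UNIV (\<lambda>_::'i. std_normal_distribution)"
  let ?Q = "PiM {..<card B} (\<lambda>_. std_normal_distribution)"
  define G where "G = distr ?P borel (\<lambda>x. \<chi> i. x i)"
  obtain f :: "real^'i \<Rightarrow> real^'i" and h :: "nat \<Rightarrow> 'i" where f: "orthogonal_transformation f" and h: "inj_on h {..<card B}"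
    and fh: "\<And>z::real^'i. (\<Sum>b\<in>B. (b \<bullet> f z)\<^sup>2) = (\<Sum>k<card B. (z $ h k)\<^sup>2)"
    by (rule orthonormal_imp_isometry[OF orth unit]) (assumption, rule that)
  have f_meas [measurable]: "f \<in> borel_measurable borel"
    using f by (intro borel_measurable_continuous_onI linear_continuous_on)
      (simp add: linear_conv_bounded_linear orthogonal_transformation)
  have inv: "distr G borel f = G"
    unfolding G_def by (rule std_normal_vector_orthogonal_invariant[OF f])
  have "distr ?P borel (\<lambda>x. \<Sum>b\<in>B. (b \<bullet> (\<chi> i. x i))\<^sup>2) = distr G borel (\<lambda>z. \<Sum>b\<in>B. (b \<bullet> z)\<^sup>2)"
    unfolding G_def by (subst distr_distr) (auto simp: comp_def)
  also have "\<dots> = distr (distr G borel f) borel (\<lambda>z. \<Sum>b\<in>B. (b \<bullet> z)\<^sup>2)"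
    unfolding inv ..
  also have "\<dots> = distr ?P borel (\<lambda>x. \<Sum>k<card B. (x (h k))\<^sup>2)"
    unfolding G_def by (simp add: distr_distr comp_def fh)
  also have "\<dots> = distr (distr ?P ?Q (\<lambda>\<omega>. \<lambda>k\<in>{..<card B}. \<omega> (h k))) borel (\<lambda>x. \<Sum>k<card B. (x k)\<^sup>2)"
  proof -
    have "(\<lambda>\<omega>. \<lambda>k\<in>{..<card B}. \<omega> (h k)) \<in> measurable ?P ?Q"
      by (intro measurable_restrict) auto
    then show ?thesis by (subst distr_distr) (auto simp: comp_def intro!: distr_cong)
  qed
  also have "distr ?P ?Q (\<lambda>\<omega>. \<lambda>k\<in>{..<card B}. \<omega> (h k)) = ?Q"
    by (rule distr_PiM_reindex) (auto simp: h prob_space_normal_density)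
  finally show ?thesis unfolding chi_squared_def .
qed

section \<open>The likelihood and its maximisers\<close>

text \<open>This is the row space of \<open>A\<close>. Componentwise \<open>ln\<close> maps the
  model onto it, which makes the model accessible to linear algebra.\<close>

definition log_space :: "real^'i^'j \<Rightarrow> (real^'i) set" where
  "log_space A = range (\<lambda>\<theta>. transpose A *v \<theta>)"

lemma RM_iff_ln: "lam \<in> RM A \<longleftrightarrow>
    (\<forall>i. 0 < lam $ i) \<and> (\<chi> i. ln (lam $ i)) \<in> log_space A"
  by (auto simp: RM_def log_space_def)

lemma subspace_log_space: "subspace (log_space A)"
  unfolding log_space_def by (rule linear_subspace_image[OF matrix_vector_mul_linear subspace_UNIV])

lemma exp_scale_in_RM:
  fixes A :: "real^'i^'j"
  assumes "lam \<in> RM A" "\<eta> \<in> log_space A"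
  shows "(\<chi> i. lam $ i * exp (\<eta> $ i)) \<in> RM A"
proof -
  have "(\<chi> i. ln (lam $ i * exp (\<eta> $ i))) = (\<chi> i. ln (lam $ i)) + \<eta>"
    using assms by (auto simp: vec_eq_iff RM_iff_ln ln_mult_pos)
  then show ?thesis
    using assms by (auto simp: RM_iff_ln intro: subspace_add[OF subspace_log_space])
qed

lemma ln_ratio_in_log_space:
  fixes A :: "real^'i^'j"
  assumes "lam \<in> RM A" "mu \<in> RM A"
  shows "(\<chi> i. ln (lam $ i / mu $ i)) \<in> log_space A"
proof -
  have "(\<chi> i. ln (lam $ i / mu $ i)) = (\<chi> i. ln (lam $ i)) - (\<chi> i. ln (mu $ i))"
    using assms by (auto simp: vec_eq_iff RM_iff_ln ln_div less_imp_neq[symmetric])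
  then show ?thesis
    using assms by (auto simp: RM_iff_ln intro: subspace_diff[OF subspace_log_space])
qed

text \<open>Coercivity in both directions: for \<open>x \<ge> 0\<close> the quadratic part of
  \<open>exp x\<close> wins after completing a square, where the \<open>+ 1\<close> pays for the
  term \<open>- \<bar>x\<bar>\<close>; for negative \<open>x\<close> the count itself, being at
  least one, forces linear decay.\<close>

lemma poisson_term_le:
  fixes x :: real and n :: nat
  assumes "0 < n"
  shows "real n * x - exp x \<le> (real n + 1)\<^sup>2 / 2 - \<bar>x\<bar>"
proof (cases "x \<ge> 0")
  case True
  then have "exp x \<ge> x\<^sup>2 / 2"
    using exp_lower_Taylor_quadratic[of x] by linarith
  moreover have "0 \<le> (x - (real n + 1))\<^sup>2" by simp
  then have "(real n + 1) * x \<le> x\<^sup>2 / 2 + (real n + 1)\<^sup>2 / 2"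
    by (simp add: power2_eq_square field_simps)
  ultimately show ?thesis using True by (simp add: algebra_simps)
next
  case False
  then have "real n * x \<le> 1 * x" using assms by (intro mult_right_mono_neg) auto
  moreover have "0 \<le> (real n + 1)\<^sup>2 / 2" by simp
  ultimately show ?thesis
    using False exp_ge_zero[of x] by linarith
qed

text \<open>In logarithmic coordinates the likelihood is continuous on a closed subspace, and
  positive counts make it coercive, so a maximum over a compact piece is a global one.\<close>

lemma MLE_exists:
  fixes A :: "real^'i^'j"
  assumes pos: "\<And>i. 0 < Y i"
  shows "Y \<in> MLE_set A"
proof -
  let ?L = "log_space A"
  define F where "F = (\<lambda>\<eta>::real^'i. \<Sum>i\<in>UNIV. real (Y i) * \<eta> $ i - exp (\<eta> $ i))"
  define C where "C = (\<Sum>i\<in>UNIV. (real (Y i) + 1)\<^sup>2 / 2)"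
  have F_le: "F \<eta> \<le> C - norm \<eta>" for \<eta>
  proof -
    have "F \<eta> \<le> (\<Sum>i\<in>UNIV. (real (Y i) + 1)\<^sup>2 / 2 - \<bar>\<eta> $ i\<bar>)"
      unfolding F_def by (intro sum_mono poisson_term_le pos)
    also have "\<dots> = C - (\<Sum>i\<in>UNIV. \<bar>\<eta> $ i\<bar>)" by (simp add: C_def sum_subtractf)
    finally show ?thesis using norm_le_l1_cart[of \<eta>] by simp
  qed
  \<comment> \<open>Outside this radius \<open>F_le\<close> puts \<open>F\<close> below
    \<open>F 0\<close>, and \<open>0\<close> itself belongs to \<open>?K\<close>.\<close>
  let ?K = "?L \<inter> cball 0 (C - F 0)"
  have "compact ?K"
    by (intro closed_Int_compact closed_subspace subspace_log_space compact_cball)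
  moreover have "0 \<in> ?K"
    using F_le[of 0] subspace_0[OF subspace_log_space[of A]] by simp
  moreover have "continuous_on ?K F"
    unfolding F_def by (intro continuous_intros)
  ultimately obtain \<eta> where \<eta>: "\<eta> \<in> ?K" and max: "\<And>\<zeta>. \<zeta> \<in> ?K \<Longrightarrow> F \<zeta> \<le> F \<eta>"
    by (metis continuous_attains_sup empty_iff)
  have max_L: "F \<zeta> \<le> F \<eta>" if "\<zeta> \<in> ?L" for \<zeta>
  proof (cases "norm \<zeta> \<le> C - F 0")
    case True
    then show ?thesis using that by (intro max) auto
  next
    case False
    then show ?thesis using F_le[of \<zeta>] max[OF \<open>0 \<in> ?K\<close>] by linarith
  qed
  have loglik_F: "loglik Y mu = F (\<chi> i. ln (mu $ i))" if "mu \<in> RM A" for mu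
    using that by (simp add: loglik_def F_def sum_subtractf RM_iff_ln)
  define lam where "lam = (\<chi> i. exp (\<eta> $ i))"
  have "lam \<in> RM A" and "(\<chi> i. ln (lam $ i)) = \<eta>"
    using \<eta> by (auto simp: RM_iff_ln lam_def)
  then have "loglik Y mu \<le> loglik Y lam" if "mu \<in> RM A" for mu
    using max_L[of "\<chi> i. ln (mu $ i)"] that by (simp add: loglik_F RM_iff_ln)
  then show ?thesis
    using \<open>lam \<in> RM A\<close> by (auto simp: MLE_set_def)
qed

lemma MLE_maximizes:
  assumes "Y \<in> MLE_set A"
  shows "MLE A Y \<in> RM A" "\<And>mu. mu \<in> RM A \<Longrightarrow> loglik Y mu \<le> loglik Y (MLE A Y)"
proof -
  have "MLE A Y \<in> RM A \<and> (\<forall>mu\<in>RM A. loglik Y mu \<le> loglik Y (MLE A Y))"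
    unfolding MLE_def by (rule someI_ex) (use assms in \<open>simp add: MLE_set_def Bex_def\<close>)
  then show "MLE A Y \<in> RM A" "\<And>mu. mu \<in> RM A \<Longrightarrow> loglik Y mu \<le> loglik Y (MLE A Y)" by auto
qed

text \<open>The curve \<open>lam $ i * exp (t * \<eta> $ i)\<close> stays in the model and passes
  through the maximiser at \<open>t = 0\<close>, so the derivative of the likelihood along it
  vanishes there.\<close>

lemma score_equation:
  fixes A :: "real^'i^'j"
  assumes lam: "lam \<in> RM A" and max: "\<And>mu. mu \<in> RM A \<Longrightarrow> loglik Y mu \<le> loglik Y lam"
    and \<eta>: "\<eta> \<in> log_space A"
  shows "(\<Sum>i\<in>UNIV. (real (Y i) - lam $ i) * \<eta> $ i) = 0"
proof -
  have pos: "0 < lam $ i" for i using lam by (simp add: RM_def)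
  define g where "g = (\<lambda>t. (\<Sum>i\<in>UNIV. real (Y i) * (ln (lam $ i) + t * \<eta> $ i)) -
      (\<Sum>i\<in>UNIV. lam $ i * exp (t * \<eta> $ i)))"
  have g_eq: "g t = loglik Y (\<chi> i. lam $ i * exp ((t *\<^sub>R \<eta>) $ i))" for t
    using pos by (simp add: g_def loglik_def ln_mult_pos)
  have "g t \<le> g 0" for t
  proof -
    have "t *\<^sub>R \<eta> \<in> log_space A"
      by (rule subspace_scale[OF subspace_log_space \<eta>])
    then have "g t \<le> loglik Y lam"
      unfolding g_eq by (intro max exp_scale_in_RM lam)
    also have "\<dots> = g 0" by (simp add: g_def loglik_def)
    finally show ?thesis .
  qed
  moreover have "(g has_field_derivative
      (\<Sum>i\<in>UNIV. real (Y i) * \<eta> $ i) - (\<Sum>i\<in>UNIV. lam $ i * \<eta> $ i)) (at 0)"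
    unfolding g_def by (auto intro!: derivative_eq_intros simp: mult.commute)
  ultimately have "(\<Sum>i\<in>UNIV. real (Y i) * \<eta> $ i) - (\<Sum>i\<in>UNIV. lam $ i * \<eta> $ i) = 0"
    by (intro DERIV_local_max[of g _ 0 1]) auto
  then show ?thesis by (simp add: left_diff_distrib sum_subtractf)
qed

text \<open>The right-hand side is quadratic near zero but only linear towards minus infinity,
  whence the denominator. For negative \<open>x\<close> the bound comes from inverting
  \<open>exp (- x) \<ge> 1 - x\<close>.\<close>

lemma exp_minus_one_mult_ge:
  fixes x :: real
  shows "x\<^sup>2 / (1 + \<bar>x\<bar>) \<le> (exp x - 1) * x"
proof (cases "x \<ge> 0")
  case True
  have "x\<^sup>2 / (1 + \<bar>x\<bar>) \<le> x\<^sup>2 / 1" using True by (intro divide_left_mono) auto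
  also have "x\<^sup>2 / 1 \<le> (exp x - 1) * x"
    using mult_right_mono[of x "exp x - 1" x] exp_ge_add_one_self[of x] True
    by (simp add: power2_eq_square del: exp_ge_add_one_self)
  finally show ?thesis .
next
  case False
  have "exp x = inverse (exp (- x))" by (simp add: exp_minus)
  also have "\<dots> \<le> inverse (1 + - x)"
    using exp_ge_add_one_self[of "- x"] False by (intro le_imp_inverse_le) auto
  finally have "- x * (1 - inverse (1 - x)) \<le> - x * (1 - exp x)"
    using False by (intro mult_left_mono) auto
  moreover have "- x * (1 - inverse (1 - x)) = x\<^sup>2 / (1 + \<bar>x\<bar>)"
    using False by (simp add: field_simps power2_eq_square)
  ultimately show ?thesis by (simp add: algebra_simps)
qed

text \<open>This will control the error of linearising the fitted means in the log-ratios. For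
  negative \<open>x\<close> the upper bound follows from \<open>exp (- x) \<ge> 1 - x\<close> and
  the factorisation of \<open>1 - x ^ 3\<close>.\<close>

lemma abs_exp_minus_linear_le:
  fixes x :: real
  assumes "\<bar>x\<bar> \<le> 1"
  shows "\<bar>exp x - 1 - x\<bar> \<le> x\<^sup>2"
proof (cases "x \<ge> 0")
  case True
  then show ?thesis
    using exp_bound[of x] exp_ge_add_one_self[of x] assms by (simp add: abs_le_iff del: exp_ge_add_one_self)
next
  case False
  have "exp x = inverse (exp (- x))" by (simp add: exp_minus)
  also have "\<dots> \<le> inverse (1 + - x)"
    using exp_ge_add_one_self[of "- x"] False by (intro le_imp_inverse_le) auto
  also have "\<dots> \<le> 1 + x + x\<^sup>2"
  proof -
    have "1 \<le> 1 + (- x) ^ 3" using False by simp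
    also have "\<dots> = (1 + x + x\<^sup>2) * (1 - x)" by (simp add: power2_eq_square power3_eq_cube algebra_simps)
    finally show ?thesis using False by (simp add: field_simps)
  qed
  finally show ?thesis
    using exp_ge_add_one_self[of x] by (simp add: abs_le_iff del: exp_ge_add_one_self)
qed

text \<open>The score equation in the direction of the log-ratio itself, combined with
  \<open>(exp x - 1) * x \<ge> x\<^sup>2 / (1 + \<bar>x\<bar>)\<close>, localises every maximiser.\<close>

lemma MLE_deviation_bound:
  fixes A :: "real^'i^'j"
  assumes lam0: "lam0 \<in> RM A" and lam: "lam \<in> RM A"
    and max: "\<And>mu. mu \<in> RM A \<Longrightarrow> loglik Y mu \<le> loglik Y lam"
    and m: "0 < m" "\<And>i. m \<le> sqrt (lam0 $ i)"
  defines "z \<equiv> \<chi> i. (real (Y i) - lam0 $ i) / sqrt (lam0 $ i)"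
    and "v \<equiv> \<chi> i. sqrt (lam0 $ i) * ln (lam $ i / lam0 $ i)"
  assumes z_le: "2 * norm z \<le> m"
  shows "norm v \<le> 2 * norm z"
proof (cases "v = 0")
  case False
  define \<eta> where "\<eta> = (\<chi> i. ln (lam $ i / lam0 $ i))"
  have pos: "0 < lam0 $ i" "0 < lam $ i" for i using lam0 lam by (auto simp: RM_def)
  have lam_eq: "lam $ i = lam0 $ i * exp (\<eta> $ i)" for i
    using pos[of i] by (simp add: \<eta>_def)
  have v_eq: "v $ i = sqrt (lam0 $ i) * \<eta> $ i" for i by (simp add: v_def \<eta>_def)
  have z_eq: "sqrt (lam0 $ i) * z $ i = real (Y i) - lam0 $ i" for i
    using pos[of i] by (simp add: z_def)
  have "(\<Sum>i\<in>UNIV. (real (Y i) - lam $ i) * \<eta> $ i) = 0"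
    unfolding \<eta>_def by (rule score_equation[OF lam max ln_ratio_in_log_space[OF lam lam0]])
  also have "(\<Sum>i\<in>UNIV. (real (Y i) - lam $ i) * \<eta> $ i) =
      (\<Sum>i\<in>UNIV. z $ i * v $ i - lam0 $ i * ((exp (\<eta> $ i) - 1) * \<eta> $ i))"
  proof (intro sum.cong refl)
    fix i
    have "real (Y i) = lam0 $ i + sqrt (lam0 $ i) * z $ i" using z_eq[of i] by simp
    then show "(real (Y i) - lam $ i) * \<eta> $ i = z $ i * v $ i - lam0 $ i * ((exp (\<eta> $ i) - 1) * \<eta> $ i)"
      unfolding lam_eq v_eq by (simp only:) (simp add: algebra_simps)
  qed
  finally have "(\<Sum>i\<in>UNIV. lam0 $ i * ((exp (\<eta> $ i) - 1) * \<eta> $ i)) = z \<bullet> v"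
    by (simp add: sum_subtractf inner_vec_def)
  also have "\<dots> \<le> norm z * norm v" by (rule norm_cauchy_schwarz)
  finally have le: "(\<Sum>i\<in>UNIV. lam0 $ i * ((exp (\<eta> $ i) - 1) * \<eta> $ i)) \<le> norm z * norm v" .
  \<comment> \<open>Every log-ratio is at most \<open>norm v / m\<close> in absolute value, so one
    common denominator serves all coordinates and the squares sum to
    \<open>norm v ^ 2\<close>.\<close>
  have "norm v ^ 2 / (1 + norm v / m) = (\<Sum>i\<in>UNIV. (v $ i)\<^sup>2 / (1 + norm v / m))"
    by (simp add: norm_vec_def L2_set_def sum_nonneg sum_divide_distrib)
  also have "\<dots> \<le> (\<Sum>i\<in>UNIV. lam0 $ i * ((exp (\<eta> $ i) - 1) * \<eta> $ i))"
  proof (rule sum_mono)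
    fix i
    have "m * \<bar>\<eta> $ i\<bar> \<le> sqrt (lam0 $ i) * \<bar>\<eta> $ i\<bar>" using m by (intro mult_right_mono) auto
    also have "\<dots> = \<bar>v $ i\<bar>" using pos[of i] by (simp add: v_eq abs_mult)
    also have "\<dots> \<le> norm v" by (rule component_le_norm_cart)
    finally have "\<bar>\<eta> $ i\<bar> \<le> norm v / m" using m by (simp add: field_simps)
    then have "(v $ i)\<^sup>2 / (1 + norm v / m) \<le> (v $ i)\<^sup>2 / (1 + \<bar>\<eta> $ i\<bar>)"
      by (intro divide_left_mono mult_pos_pos) (auto simp: add_pos_nonneg m less_imp_le)
    also have "\<dots> = lam0 $ i * ((\<eta> $ i)\<^sup>2 / (1 + \<bar>\<eta> $ i\<bar>))"
      using pos[of i] by (simp add: v_eq power_mult_distrib)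
    also have "\<dots> \<le> lam0 $ i * ((exp (\<eta> $ i) - 1) * \<eta> $ i)"
      using pos[of i] by (intro mult_left_mono exp_minus_one_mult_ge) auto
    finally show "(v $ i)\<^sup>2 / (1 + norm v / m) \<le> lam0 $ i * ((exp (\<eta> $ i) - 1) * \<eta> $ i)" .
  qed
  also note le
  finally have "norm v ^ 2 \<le> norm z * norm v * (1 + norm v / m)"
    using m by (simp add: pos_divide_le_eq add_pos_nonneg)
  then have "norm v * norm v \<le> norm v * (norm z * (1 + norm v / m))"
    by (simp add: power2_eq_square mult_ac)
  then have "norm v \<le> norm z * (1 + norm v / m)"
    using False by simp
  also have "\<dots> = norm z + (norm z / m) * norm v" by (simp add: algebra_simps)
  \<comment> \<open>The assumption \<open>z_le\<close> makes the coefficient of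
    \<open>norm v\<close> at most one half; absorbing it on the left yields the factor 2.\<close>
  also have "\<dots> \<le> norm z + (1 / 2) * norm v"
    using z_le m by (intro add_left_mono mult_right_mono) (auto simp: field_simps)
  finally show ?thesis by simp
qed simp

text \<open>This ties the Bregman summands to squared residuals. One use of l'Hopital's rule leaves
  \<open>ln (1 + t) / t\<close>, the difference quotient of \<open>ln\<close> at one.\<close>

lemma tendsto_entropy_remainder:
  "((\<lambda>t::real. 2 * ((1 + t) * ln (1 + t) - t) / t\<^sup>2) \<longlongrightarrow> 1) (at 0)"
proof (rule lhopital)
  have near: "eventually (\<lambda>t::real. - 1 < t) (at 0)"
    using eventually_at_in_open'[of "{-1<..}" "0::real"] by simp
  show "eventually (\<lambda>t::real. ((\<lambda>t. 2 * ((1 + t) * ln (1 + t) - t)) has_real_derivative 2 * ln (1 + t)) (at t)) (at 0)"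
    using near
  proof eventually_elim
    case (elim t)
    then have "1 + t \<noteq> 0" by simp
    moreover have "((\<lambda>t. 2 * ((1 + t) * ln (1 + t) - t)) has_real_derivative
        2 * (1 * ln (1 + t) + 1 / (1 + t) * (1 + t) - 1)) (at t)"
      using elim by (intro DERIV_cmult DERIV_diff DERIV_mult DERIV_ident)
        (auto intro!: derivative_eq_intros)
    ultimately show ?case by simp
  qed
  show "eventually (\<lambda>t::real. ((\<lambda>t. t\<^sup>2) has_real_derivative 2 * t) (at t)) (at 0)"
    by (intro always_eventually) (auto intro!: derivative_eq_intros)
  show "eventually (\<lambda>t::real. t\<^sup>2 \<noteq> 0) (at 0)" "eventually (\<lambda>t::real. 2 * t \<noteq> 0) (at 0)"
    using eventually_neq_at_within[of "0::real" 0 UNIV] by simp_all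
  have "((\<lambda>t::real. ln (1 + t)) has_real_derivative 1) (at 0)"
    by (auto intro!: derivative_eq_intros)
  then show "((\<lambda>t::real. 2 * ln (1 + t) / (2 * t)) \<longlongrightarrow> 1) (at 0)"
    by (simp add: has_field_derivative_iff)
  show "((\<lambda>t::real. 2 * ((1 + t) * ln (1 + t) - t)) \<longlongrightarrow> 0) (at 0)"
    by (auto intro!: tendsto_eq_intros)
  show "((\<lambda>t::real. t\<^sup>2) \<longlongrightarrow> 0) (at 0)"
    by (auto intro!: tendsto_eq_intros)
qed

section \<open>Limits of the statistics\<close>

text \<open>Parseval's identity, used to expand the standardised residual in a basis of the space
  containing it.\<close>

lemma norm_power2_orthonormal_span:
  fixes w :: "'a::real_inner"
  assumes fin: "finite B" and orth: "pairwise orthogonal B" and unit: "\<And>b. b \<in> B \<Longrightarrow> norm b = 1"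
    and w: "w \<in> span B"
  shows "(norm w)\<^sup>2 = (\<Sum>b\<in>B. (b \<bullet> w)\<^sup>2)"
proof -
  obtain u where u: "w = (\<Sum>b\<in>B. u b *\<^sub>R b)"
    using w span_finite[OF fin] by auto
  have b_w: "b \<bullet> w = u b" if "b \<in> B" for b
  proof -
    have "b \<bullet> w = (\<Sum>c\<in>B. u c * (b \<bullet> c))" by (simp add: u inner_sum_right)
    also have "\<dots> = (\<Sum>c\<in>B. if c = b then u c else 0)"
      using orth that unit[OF that]
      by (intro sum.cong) (auto simp: pairwise_def orthogonal_def dot_square_norm)
    finally show ?thesis using fin that by simp
  qed
  have "(norm w)\<^sup>2 = (\<Sum>b\<in>B. u b * (b \<bullet> w))"
    by (simp add: power2_norm_eq_inner) (subst (1) u, simp add: inner_sum_left)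
  also have "\<dots> = (\<Sum>b\<in>B. (b \<bullet> w)\<^sup>2)"
    by (intro sum.cong) (auto simp: b_w power2_eq_square)
  finally show ?thesis .
qed

text \<open>Each difference of squares factors, and Cauchy-Schwarz bounds both factors. Only the
  cardinality of \<open>B\<close> enters, so the estimate is uniform over moving bases of fixed
  size.\<close>

lemma sum_inner_squares_diff_le:
  fixes x y :: "'a::real_inner"
  assumes unit: "\<And>b. b \<in> B \<Longrightarrow> norm b = 1"
  shows "\<bar>(\<Sum>b\<in>B. (b \<bullet> x)\<^sup>2) - (\<Sum>b\<in>B. (b \<bullet> y)\<^sup>2)\<bar> \<le> real (card B) * (norm (x - y) * norm (x + y))"
proof -
  have "\<bar>(b \<bullet> x)\<^sup>2 - (b \<bullet> y)\<^sup>2\<bar> \<le> norm (x - y) * norm (x + y)" if "b \<in> B" for b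
  proof -
    have "(b \<bullet> x)\<^sup>2 - (b \<bullet> y)\<^sup>2 = (b \<bullet> (x - y)) * (b \<bullet> (x + y))"
      by (simp add: power2_eq_square algebra_simps inner_diff_right inner_add_right)
    then show ?thesis
      using Cauchy_Schwarz_ineq2[of b "x - y"] Cauchy_Schwarz_ineq2[of b "x + y"] unit[OF that]
      by (simp add: abs_mult mult_mono)
  qed
  then show ?thesis
    unfolding sum_subtractf[symmetric]
    by (intro order_trans[OF sum_abs] sum_bounded_above) auto
qed

lemma transpose_mult_inner:
  fixes A :: "real^'i^'j"
  shows "(transpose A *v \<theta>) \<bullet> x = \<theta> \<bullet> (A *v x)"
  by (metis dot_lmul_matrix transpose_matrix_vector)

text \<open>This deterministic statement is applied at each sample point. Since the bases move with
  \<open>r\<close> while \<open>zl\<close> is fixed, the statistics are compared with sums depending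
  on \<open>r\<close>, not with one limit value.\<close>

lemma statistics_limit:
  fixes A :: "real^'i^'j" and lam0 :: "nat \<Rightarrow> real^'i" and Y :: "nat \<Rightarrow> 'i \<Rightarrow> nat"
  assumes in_model: "\<And>r. lam0 r \<in> RM A"
    and to_infty: "filterlim (\<lambda>r. Min (range (\<lambda>i. lam0 r $ i))) at_top sequentially"
    and z_lim: "(\<lambda>r. \<chi> i. (real (Y r i) - lam0 r $ i) / sqrt (lam0 r $ i)) \<longlonglongrightarrow> zl"
    and B: "\<And>r. finite (B r)" "\<And>r. pairwise orthogonal (B r)" "\<And>r b. b \<in> B r \<Longrightarrow> norm b = 1"
      "\<And>r. card (B r) = K" "\<And>r. span (B r) = {w. A *v (\<chi> i. sqrt (lam0 r $ i) * w $ i) = 0}"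
  shows "eventually (\<lambda>r. Y r \<in> MLE_set A) sequentially"
    and "(\<lambda>r. pearson (yvec (Y r)) (MLE A (Y r)) - (\<Sum>b\<in>B r. (b \<bullet> zl)\<^sup>2)) \<longlonglongrightarrow> 0"
    and "(\<lambda>r. bregman (yvec (Y r)) (MLE A (Y r)) - (\<Sum>b\<in>B r. (b \<bullet> zl)\<^sup>2)) \<longlonglongrightarrow> 0"
proof -
  define z where "z = (\<lambda>r. \<chi> i. (real (Y r i) - lam0 r $ i) / sqrt (lam0 r $ i))"
  \<comment> \<open>The square root of the smallest mean bounds all coordinate scales from below, so
    \<open>norm (v r) / m r\<close> controls all log-ratios at once.\<close>
  define m where "m = (\<lambda>r. sqrt (Min (range (\<lambda>i. lam0 r $ i))))"
  have lam0_pos: "0 < lam0 r $ i" for r i using in_model[of r] by (simp add: RM_def)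
  have m_pos: "0 < m r" for r using lam0_pos by (simp add: m_def)
  have m_le: "m r \<le> sqrt (lam0 r $ i)" for r i by (simp add: m_def)
  have m_lim: "filterlim m at_top sequentially"
    unfolding m_def by (rule filterlim_compose[OF sqrt_at_top to_infty])
  have z_lim': "z \<longlonglongrightarrow> zl" using z_lim by (simp add: z_def)
  have norm_z: "(\<lambda>r. norm (z r)) \<longlonglongrightarrow> norm zl" by (intro tendsto_intros z_lim')
  have z_m: "(\<lambda>r. norm (z r) / m r) \<longlonglongrightarrow> 0"
    by (rule real_tendsto_divide_at_top[OF norm_z m_lim])
  have small: "eventually (\<lambda>r. 2 * norm (z r) < m r) sequentially"
    using order_tendstoD(2)[OF z_m, of "1/2"] m_pos
    by (auto elim!: eventually_mono simp: field_simps)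
  have Y_eq: "real (Y r i) = lam0 r $ i + sqrt (lam0 r $ i) * z r $ i" for r i
    using lam0_pos[of r i] by (simp add: z_def)
  have E: "eventually (\<lambda>r. Y r \<in> MLE_set A) sequentially"
    using small
  proof eventually_elim
    case (elim r)
    show ?case
    proof (rule MLE_exists)
      fix i
      have "\<bar>z r $ i\<bar> < sqrt (lam0 r $ i)"
        using component_le_norm_cart[of "z r" i] elim m_le[of r i] norm_ge_zero[of "z r"] by linarith
      then have "0 < sqrt (lam0 r $ i) * (sqrt (lam0 r $ i) + z r $ i)"
        using lam0_pos[of r i] by (intro mult_pos_pos) auto
      then have "0 < real (Y r i)"
        using lam0_pos[of r i] by (simp add: Y_eq distrib_left)
      then show "0 < Y r i" by simp
    qed
  qed
  then show "eventually (\<lambda>r. Y r \<in> MLE_set A) sequentially" .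

  \<comment> \<open>The default \<open>lam0 r\<close> keeps \<open>lam r\<close> in the model for
    every \<open>r\<close>; eventually it is not taken.\<close>
  define lam where "lam = (\<lambda>r. if Y r \<in> MLE_set A then MLE A (Y r) else lam0 r)"
  have lam_RM: "lam r \<in> RM A" for r
    using MLE_maximizes(1) in_model by (auto simp: lam_def)
  then have lam_pos: "0 < lam r $ i" for r i by (simp add: RM_def)
  define \<eta> where "\<eta> = (\<lambda>r i. ln (lam r $ i / lam0 r $ i))"
  define v where "v = (\<lambda>r. \<chi> i. sqrt (lam0 r $ i) * \<eta> r i)"
  define e where "e = (\<lambda>r. \<chi> i. sqrt (lam0 r $ i) * (exp (\<eta> r i) - 1 - \<eta> r i))"
  \<comment> \<open>\<open>v\<close> is orthogonal to \<open>span (B r)\<close>, the standardised residual \<open>w\<close> lies in it, and \<open>e\<close> vanishes.\<close>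
  define w where "w = (\<lambda>r. z r - v r - e r)"
  have lam_eq: "lam r $ i = lam0 r $ i * exp (\<eta> r i)" for r i
    using lam0_pos[of r i] lam_pos[of r i] by (simp add: \<eta>_def)
  have w_eq: "sqrt (lam0 r $ i) * w r $ i = real (Y r i) - lam r $ i" for r i
    using lam0_pos[of r i] by (simp add: w_def v_def e_def Y_eq lam_eq algebra_simps)
  have v_le: "eventually (\<lambda>r. norm (v r) \<le> 2 * norm (z r)) sequentially"
    using small E
  proof eventually_elim
    case (elim r)
    have "loglik (Y r) mu \<le> loglik (Y r) (lam r)" if "mu \<in> RM A" for mu
      using MLE_maximizes(2)[of "Y r" A mu] that elim(2) by (simp add: lam_def)
    then show ?case
      using MLE_deviation_bound[OF in_model[of r] lam_RM[of r] _ m_pos[of r] m_le, of "Y r"] elim(1)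
      by (simp add: z_def v_def \<eta>_def)
  qed
  have \<eta>_le: "\<bar>\<eta> r i\<bar> \<le> norm (v r) / m r" for r i
  proof -
    have "m r * \<bar>\<eta> r i\<bar> \<le> sqrt (lam0 r $ i) * \<bar>\<eta> r i\<bar>" by (intro mult_right_mono m_le) auto
    also have "\<dots> = \<bar>v r $ i\<bar>" using lam0_pos[of r i] by (simp add: v_def abs_mult)
    also have "\<dots> \<le> norm (v r)" by (rule component_le_norm_cart)
    finally show ?thesis using m_pos[of r] by (simp add: field_simps)
  qed
  have v_m: "(\<lambda>r. norm (v r) / m r) \<longlonglongrightarrow> 0"
  proof (rule Lim_null_comparison)
    show "eventually (\<lambda>r. norm (norm (v r) / m r) \<le> 2 * (norm (z r) / m r)) sequentially"
      using v_le by eventually_elim (use m_pos in \<open>simp add: divide_right_mono less_imp_le\<close>)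
    show "(\<lambda>r. 2 * (norm (z r) / m r)) \<longlonglongrightarrow> 0"
      using tendsto_mult_right_zero[OF z_m] by simp
  qed
  have \<eta>_lim: "(\<lambda>r. \<eta> r i) \<longlonglongrightarrow> 0" for i
    by (rule Lim_null_comparison[OF _ v_m]) (simp add: \<eta>_le)
  \<comment> \<open>A component of \<open>e\<close> is at most a scale times a squared log-ratio,
    that is, a component of \<open>v\<close> times a log-ratio: a bounded factor times a vanishing
    one.\<close>
  have e_lim: "e \<longlonglongrightarrow> 0"
  proof (rule vec_tendstoI)
    fix i
    have "(\<lambda>r. e r $ i) \<longlonglongrightarrow> 0"
    proof (rule Lim_null_comparison)
      have "eventually (\<lambda>r. \<bar>\<eta> r i\<bar> < 1) sequentially"
        using order_tendstoD(2)[OF tendsto_rabs[OF \<eta>_lim[of i]], of 1] by simp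
      with v_le show "eventually (\<lambda>r. norm (e r $ i) \<le> 2 * norm (z r) * \<bar>\<eta> r i\<bar>) sequentially"
      proof eventually_elim
        case (elim r)
        have "norm (e r $ i) = sqrt (lam0 r $ i) * \<bar>exp (\<eta> r i) - 1 - \<eta> r i\<bar>"
          using lam0_pos[of r i] by (simp add: e_def abs_mult)
        also have "\<dots> \<le> sqrt (lam0 r $ i) * (\<eta> r i)\<^sup>2"
          using elim lam0_pos[of r i] by (intro mult_left_mono abs_exp_minus_linear_le) auto
        also have "\<dots> = \<bar>v r $ i\<bar> * \<bar>\<eta> r i\<bar>"
          using lam0_pos[of r i] by (simp add: v_def abs_mult power2_eq_square)
        also have "\<dots> \<le> 2 * norm (z r) * \<bar>\<eta> r i\<bar>"
          using component_le_norm_cart[of "v r" i] elim by (intro mult_right_mono) auto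
        finally show ?case .
      qed
      have "(\<lambda>r. 2 * norm (z r) * \<bar>\<eta> r i\<bar>) \<longlonglongrightarrow> 2 * norm zl * \<bar>0\<bar>"
        by (intro tendsto_intros norm_z \<eta>_lim)
      then show "(\<lambda>r. 2 * norm (z r) * \<bar>\<eta> r i\<bar>) \<longlonglongrightarrow> 0" by simp
    qed
    then show "(\<lambda>r. e r $ i) \<longlonglongrightarrow> 0 $ i" by simp
  qed

  let ?T = "\<lambda>r. \<Sum>b\<in>B r. (b \<bullet> zl)\<^sup>2"
  have w_norm: "eventually (\<lambda>r. (norm (w r))\<^sup>2 = (\<Sum>b\<in>B r. (b \<bullet> (z r - e r))\<^sup>2)) sequentially"
    using E
  proof eventually_elim
    case (elim r)
    let ?s = "\<lambda>x::real^'i. \<chi> i. sqrt (lam0 r $ i) * x $ i"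
    have max: "loglik (Y r) mu \<le> loglik (Y r) (lam r)" if "mu \<in> RM A" for mu
      using MLE_maximizes(2)[of "Y r" A mu] that elim by (simp add: lam_def)
    \<comment> \<open>Transposing \<open>A\<close> turns \<open>\<theta>\<close> into an arbitrary
      direction of the row space, where the score equation applies.\<close>
    have "\<theta> \<bullet> (A *v ?s (w r)) = 0" for \<theta>
    proof -
      have "\<theta> \<bullet> (A *v ?s (w r)) = (transpose A *v \<theta>) \<bullet> ?s (w r)"
        by (rule transpose_mult_inner[symmetric])
      also have "\<dots> = (\<Sum>i\<in>UNIV. (real (Y r i) - lam r $ i) * (transpose A *v \<theta>) $ i)"
        unfolding inner_vec_def by (intro sum.cong refl) (simp add: w_eq)
      also have "\<dots> = 0"
        by (rule score_equation[OF lam_RM max]) (auto simp: log_space_def)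
      finally show ?thesis .
    qed
    then have "A *v ?s (w r) = 0" by (metis inner_eq_zero_iff)
    then have w_span: "w r \<in> span (B r)" by (simp add: B(5))
    have b_v: "b \<bullet> v r = 0" if "b \<in> B r" for b
    proof -
      have "b \<in> span (B r)" using that by (rule span_base)
      then have b: "A *v ?s b = 0" by (simp add: B(5))
      obtain \<theta> where "(\<chi> i. \<eta> r i) = transpose A *v \<theta>"
        using ln_ratio_in_log_space[OF lam_RM[of r] in_model[of r]] unfolding log_space_def \<eta>_def by blast
      then have "(\<chi> i. \<eta> r i) \<bullet> ?s b = 0"
        by (simp only: transpose_mult_inner b inner_zero_right)
      then show ?thesis by (simp add: inner_vec_def v_def mult_ac)
    qed
    have "(norm (w r))\<^sup>2 = (\<Sum>b\<in>B r. (b \<bullet> w r)\<^sup>2)"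
      by (rule norm_power2_orthonormal_span[OF B(1,2) _ w_span]) (rule B(3))
    also have "\<dots> = (\<Sum>b\<in>B r. (b \<bullet> (z r - e r))\<^sup>2)"
      by (intro sum.cong refl) (simp add: w_def inner_diff_right b_v)
    finally show ?case .
  qed
  have sq_diff: "\<bar>(\<Sum>b\<in>B r. (b \<bullet> x)\<^sup>2) - (\<Sum>b\<in>B r. (b \<bullet> y)\<^sup>2)\<bar> \<le> real K * (norm (x - y) * norm (x + y))"
    for r x y
    using sum_inner_squares_diff_le[of "B r" x y] B(3) by (simp add: B(4))
  have ze_lim: "(\<lambda>r. z r - e r) \<longlonglongrightarrow> zl"
    using tendsto_diff[OF z_lim' e_lim] by simp
  have "(\<lambda>r. (\<Sum>b\<in>B r. (b \<bullet> (z r - e r))\<^sup>2) - ?T r) \<longlonglongrightarrow> 0"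
  proof (rule Lim_null_comparison)
    show "eventually (\<lambda>r. norm ((\<Sum>b\<in>B r. (b \<bullet> (z r - e r))\<^sup>2) - ?T r) \<le>
        real K * (norm (z r - e r - zl) * norm (z r - e r + zl))) sequentially"
      by (simp add: sq_diff)
    have "(\<lambda>r. real K * (norm (z r - e r - zl) * norm (z r - e r + zl))) \<longlonglongrightarrow>
        real K * (norm (zl - zl) * norm (zl + zl))"
      by (intro tendsto_intros ze_lim)
    then show "(\<lambda>r. real K * (norm (z r - e r - zl) * norm (z r - e r + zl))) \<longlonglongrightarrow> 0"
      by simp
  qed
  then have w_T: "(\<lambda>r. (norm (w r))\<^sup>2 - ?T r) \<longlonglongrightarrow> 0"
    by (rule Lim_transform_eventually) (use w_norm in \<open>auto elim: eventually_mono\<close>)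
  \<comment> \<open>Comparison with the zero vector in \<open>sq_diff\<close> gives the factor
    \<open>K\<close>, and \<open>z r - e r\<close> eventually has norm below
    \<open>norm zl + 1\<close>.\<close>
  define C where "C = real K * ((norm zl + 1)\<^sup>2)"
  have w_bdd: "eventually (\<lambda>r. (norm (w r))\<^sup>2 \<le> C) sequentially"
  proof -
    have "eventually (\<lambda>r. norm (z r - e r) < norm zl + 1) sequentially"
      using order_tendstoD(2)[OF tendsto_norm[OF ze_lim], of "norm zl + 1"] by simp
    with w_norm show ?thesis
    proof eventually_elim
      case (elim r)
      have "(norm (w r))\<^sup>2 \<le> real K * (norm (z r - e r))\<^sup>2"
        using sq_diff[where r = r and x = "z r - e r" and y = 0] elim(1)
        by (simp add: power2_eq_square)
      also have "\<dots> \<le> C"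
        unfolding C_def using elim(2) by (intro mult_left_mono power_mono) auto
      finally show ?case .
    qed
  qed
  have wi_bdd: "eventually (\<lambda>r. (w r $ i)\<^sup>2 \<le> C) sequentially" for i
    using w_bdd
  proof eventually_elim
    case (elim r)
    have "\<bar>w r $ i\<bar>\<^sup>2 \<le> (norm (w r))\<^sup>2"
      by (intro power_mono component_le_norm_cart) auto
    then show ?case using elim by simp
  qed
  \<comment> \<open>Both statistics are such weighted sums; as the squares stay bounded, weights
    tending to one do not affect the limit.\<close>
  have weighted: "(\<lambda>r. (\<Sum>i\<in>UNIV. (w r $ i)\<^sup>2 * \<kappa> r i) - ?T r) \<longlonglongrightarrow> 0"
    if \<kappa>: "\<And>i. (\<lambda>r. \<kappa> r i) \<longlonglongrightarrow> 1" for \<kappa>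
  proof -
    have "(\<lambda>r. (w r $ i)\<^sup>2 * (\<kappa> r i - 1)) \<longlonglongrightarrow> 0" for i
    proof (rule Lim_null_comparison)
      show "eventually (\<lambda>r. norm ((w r $ i)\<^sup>2 * (\<kappa> r i - 1)) \<le> C * \<bar>\<kappa> r i - 1\<bar>) sequentially"
        using wi_bdd[of i] by eventually_elim (simp add: abs_mult mult_right_mono)
      have "(\<lambda>r. C * \<bar>\<kappa> r i - 1\<bar>) \<longlonglongrightarrow> C * \<bar>1 - 1\<bar>" by (intro tendsto_intros \<kappa>)
      then show "(\<lambda>r. C * \<bar>\<kappa> r i - 1\<bar>) \<longlonglongrightarrow> 0" by simp
    qed
    then have "(\<lambda>r. (\<Sum>i\<in>UNIV. (w r $ i)\<^sup>2 * (\<kappa> r i - 1)) + ((norm (w r))\<^sup>2 - ?T r)) \<longlonglongrightarrow> (\<Sum>i\<in>(UNIV::'i set). 0) + 0"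
      by (intro tendsto_add tendsto_sum w_T)
    moreover have "(norm (w r))\<^sup>2 = (\<Sum>i\<in>UNIV. (w r $ i)\<^sup>2)" for r
      by (simp add: norm_vec_def L2_set_def sum_nonneg)
    ultimately show ?thesis by (simp add: right_diff_distrib sum_subtractf)
  qed

  have exp_lim: "(\<lambda>r. exp (- \<eta> r i)) \<longlonglongrightarrow> 1" for i
    using tendsto_exp[OF tendsto_minus[OF \<eta>_lim[of i]]] by simp
  \<comment> \<open>Dividing by the fitted mean instead of \<open>lam0\<close> leaves the weight
    \<open>exp (- \<eta> r i)\<close>.\<close>
  have "pearson (yvec (Y r)) (lam r) = (\<Sum>i\<in>UNIV. (w r $ i)\<^sup>2 * exp (- \<eta> r i))" for r
    unfolding pearson_def
  proof (intro sum.cong refl)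
    fix i
    have "(yvec (Y r) $ i - lam r $ i)\<^sup>2 = lam0 r $ i * (w r $ i)\<^sup>2"
      using lam0_pos[of r i] by (simp add: yvec_def w_eq[symmetric] power_mult_distrib)
    then show "(yvec (Y r) $ i - lam r $ i)\<^sup>2 / lam r $ i = (w r $ i)\<^sup>2 * exp (- \<eta> r i)"
      using lam0_pos[of r i] by (simp add: lam_eq exp_minus field_simps)
  qed
  with weighted[OF exp_lim] have "(\<lambda>r. pearson (yvec (Y r)) (lam r) - ?T r) \<longlonglongrightarrow> 0"
    by simp
  then show "(\<lambda>r. pearson (yvec (Y r)) (MLE A (Y r)) - ?T r) \<longlonglongrightarrow> 0"
    by (rule Lim_transform_eventually) (use E in \<open>auto elim: eventually_mono simp: lam_def\<close>)

  \<comment> \<open>This is the relative residual, the observed count over the fitted mean minus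
    one.\<close>
  define t where "t = (\<lambda>r i. w r $ i / sqrt (lam0 r $ i) * exp (- \<eta> r i))"
  \<comment> \<open>The value 1 at zero makes \<open>\<psi>\<close> continuous there, so exact fits,
    where \<open>t r i\<close> is zero, need no separate treatment.\<close>
  define \<psi> where "\<psi> = (\<lambda>t::real. if t = 0 then 1 else 2 * ((1 + t) * ln (1 + t) - t) / t\<^sup>2)"
  have "(\<psi> \<longlongrightarrow> 1) (at 0)"
    using tendsto_entropy_remainder
    by (rule Lim_transform_eventually) (auto simp: \<psi>_def eventually_at_filter)
  then have \<psi>_cont: "isCont \<psi> 0" by (simp add: isCont_def \<psi>_def)
  have t_lim: "(\<lambda>r. t r i) \<longlonglongrightarrow> 0" for i
  proof -
    have "(\<lambda>r. w r $ i / sqrt (lam0 r $ i)) \<longlonglongrightarrow> 0"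
    proof (rule Lim_null_comparison)
      show "eventually (\<lambda>r. norm (w r $ i / sqrt (lam0 r $ i)) \<le> sqrt C / m r) sequentially"
        using wi_bdd[of i]
      proof eventually_elim
        case (elim r)
        have "\<bar>w r $ i\<bar> \<le> sqrt C" using elim by (intro real_le_rsqrt) simp
        then show ?case
          using m_pos[of r] m_le[of r i] lam0_pos[of r i]
          by (auto simp: abs_divide C_def intro!: frac_le)
      qed
      show "(\<lambda>r. sqrt C / m r) \<longlonglongrightarrow> 0"
        by (rule real_tendsto_divide_at_top[OF tendsto_const m_lim])
    qed
    from tendsto_mult[OF this exp_lim[of i]] show ?thesis by (simp add: t_def)
  qed
  have \<psi>_lim: "(\<lambda>r. \<psi> (t r i)) \<longlonglongrightarrow> 1" for i
    using isCont_tendsto_compose[OF \<psi>_cont t_lim[of i]] by (simp add: \<psi>_def)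
  have "bregman (yvec (Y r)) (lam r) = (\<Sum>i\<in>UNIV. (w r $ i)\<^sup>2 * (exp (- \<eta> r i) * \<psi> (t r i)))" for r
    unfolding bregman_def sum_distrib_left
  proof (intro sum.cong refl)
    fix i
    have sq: "sqrt (lam0 r $ i) * sqrt (lam0 r $ i) = lam0 r $ i" using lam0_pos[of r i] by simp
    have lt: "lam r $ i * t r i = sqrt (lam0 r $ i) * w r $ i"
      using lam0_pos[of r i] sq by (simp add: t_def lam_eq exp_minus field_simps)
    then have y: "real (Y r i) = lam r $ i * (1 + t r i)"
      using w_eq[of r i] by (simp add: algebra_simps)
    have quad: "(w r $ i)\<^sup>2 * exp (- \<eta> r i) = lam r $ i * (t r i)\<^sup>2"
    proof -
      have "lam r $ i * (t r i)\<^sup>2 = (sqrt (lam0 r $ i) * w r $ i) * t r i"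
        by (simp add: lt[symmetric] power2_eq_square)
      also have "\<dots> = (w r $ i)\<^sup>2 * exp (- \<eta> r i)"
        using lam0_pos[of r i] by (simp add: t_def power2_eq_square)
      finally show ?thesis ..
    qed
    have "2 * (yvec (Y r) $ i * ln (yvec (Y r) $ i / lam r $ i) - (yvec (Y r) $ i - lam r $ i)) =
        lam r $ i * (2 * ((1 + t r i) * ln (1 + t r i) - t r i))"
    proof -
      have "real (Y r i) / lam r $ i = 1 + t r i" using lam_pos[of r i] y by simp
      then have "ln (yvec (Y r) $ i / lam r $ i) = ln (1 + t r i)" by (simp add: yvec_def)
      then show ?thesis by (simp only:) (simp add: yvec_def y algebra_simps)
    qed
    also have "\<dots> = lam r $ i * ((t r i)\<^sup>2 * \<psi> (t r i))"
      by (simp add: \<psi>_def)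
    finally show "2 * (yvec (Y r) $ i * ln (yvec (Y r) $ i / lam r $ i) - (yvec (Y r) $ i - lam r $ i)) =
        (w r $ i)\<^sup>2 * (exp (- \<eta> r i) * \<psi> (t r i))"
      by (simp add: quad mult.assoc[symmetric])
  qed
  moreover have "(\<lambda>r. exp (- \<eta> r i) * \<psi> (t r i)) \<longlonglongrightarrow> 1" for i
    using tendsto_mult[OF exp_lim[of i] \<psi>_lim[of i]] by simp
  ultimately have "(\<lambda>r. bregman (yvec (Y r)) (lam r) - ?T r) \<longlonglongrightarrow> 0"
    using weighted[of "\<lambda>r i. exp (- \<eta> r i) * \<psi> (t r i)"] by simp
  then show "(\<lambda>r. bregman (yvec (Y r)) (MLE A (Y r)) - ?T r) \<longlonglongrightarrow> 0"
    by (rule Lim_transform_eventually) (use E in \<open>auto elim: eventually_mono simp: lam_def\<close>)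
qed

text \<open>Intersecting with \<open>E\<close> changes a probability by at most that of the
  complement of \<open>E\<close>, which vanishes; dividing by the probability of \<open>E\<close>
  then preserves the limit. The condition \<open>ne\<close> makes \<open>cond_pmf\<close> meaningful
  for every \<open>r\<close>.\<close>

lemma weak_conv_m_cond_pmf:
  fixes F :: "'a \<Rightarrow> real"
  assumes conv: "weak_conv_m (\<lambda>r. measure_pmf (map_pmf F (p r))) \<mu>"
    and E: "(\<lambda>r. measure_pmf.prob (p r) E) \<longlonglongrightarrow> 1"
    and ne: "\<And>r. set_pmf (p r) \<inter> E \<noteq> {}"
  shows "weak_conv_m (\<lambda>r. measure_pmf (map_pmf F (cond_pmf (p r) E))) \<mu>"
  unfolding weak_conv_m_def weak_conv_def
proof (intro allI impI)
  fix x assume "isCont (cdf \<mu>) x"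
  define G where "G = F -` {..x}"
  have L: "(\<lambda>r. measure_pmf.prob (p r) G) \<longlonglongrightarrow> cdf \<mu> x"
    using conv \<open>isCont (cdf \<mu>) x\<close>
    by (simp add: weak_conv_m_def weak_conv_def cdf_def G_def measure_map_pmf)
  have cond: "cdf (measure_pmf (map_pmf F (cond_pmf (p r) E))) x =
      measure_pmf.prob (p r) (E \<inter> G) / measure_pmf.prob (p r) E" for r
  proof -
    have "emeasure (measure_pmf (p r)) E \<noteq> 0"
      by (rule emeasure_measure_pmf_not_zero[OF ne])
    then show ?thesis
      by (simp add: cdf_def G_def measure_map_pmf cond_pmf.rep_eq[OF ne])
  qed
  have "(\<lambda>r. measure_pmf.prob (p r) (E \<inter> G)) \<longlonglongrightarrow> cdf \<mu> x"
  proof (rule tendsto_sandwich[OF _ _ _ L])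
    show "eventually (\<lambda>r. measure_pmf.prob (p r) G - (1 - measure_pmf.prob (p r) E) \<le>
        measure_pmf.prob (p r) (E \<inter> G)) sequentially"
    proof (intro always_eventually allI)
      fix r
      have "measure_pmf.prob (p r) G \<le> measure_pmf.prob (p r) ((E \<inter> G) \<union> (UNIV - E))"
        by (intro measure_pmf.finite_measure_mono) auto
      also have "\<dots> \<le> measure_pmf.prob (p r) (E \<inter> G) + measure_pmf.prob (p r) (UNIV - E)"
        by (rule measure_Un_le) auto
      also have "measure_pmf.prob (p r) (UNIV - E) = 1 - measure_pmf.prob (p r) E"
        using measure_pmf.prob_compl[of E "p r"] by simp
      finally show "measure_pmf.prob (p r) G - (1 - measure_pmf.prob (p r) E) \<le>
          measure_pmf.prob (p r) (E \<inter> G)" by simp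
    qed
    show "eventually (\<lambda>r. measure_pmf.prob (p r) (E \<inter> G) \<le> measure_pmf.prob (p r) G) sequentially"
      by (intro always_eventually allI measure_pmf.finite_measure_mono) auto
    show "(\<lambda>r. measure_pmf.prob (p r) G - (1 - measure_pmf.prob (p r) E)) \<longlonglongrightarrow> cdf \<mu> x"
      using tendsto_diff[OF L tendsto_diff[OF tendsto_const[of 1] E]] by simp
  qed
  from tendsto_divide[OF this E]
  show "(\<lambda>r. cdf (measure_pmf (map_pmf F (cond_pmf (p r) E))) x) \<longlonglongrightarrow> cdf \<mu> x"
    unfolding cond by simp
qed

text \<open>The coordinatewise couplings are placed on a product space. Independence gives the joint
  laws, and pointwise convergence of vectors is convergence in each coordinate.\<close>

lemma poisson_model_coupling:
  fixes lam0 :: "nat \<Rightarrow> real^'i"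
  assumes pos: "\<And>r i. 0 < lam0 r $ i"
    and lim: "\<And>i. filterlim (\<lambda>r. lam0 r $ i) at_top sequentially"
  obtains M :: "('i \<Rightarrow> real) measure" and N :: "nat \<Rightarrow> ('i \<Rightarrow> real) \<Rightarrow> 'i \<Rightarrow> nat"
    and Z :: "('i \<Rightarrow> real) \<Rightarrow> 'i \<Rightarrow> real"
  where "prob_space M"
    and "\<And>r. N r \<in> measurable M (count_space UNIV)"
    and "\<And>r. distr M (count_space UNIV) (N r) = measure_pmf (poisson_model (lam0 r))"
    and "Z \<in> measurable M (PiM UNIV (\<lambda>_. borel))"
    and "distr M (PiM UNIV (\<lambda>_. borel)) Z = PiM UNIV (\<lambda>_. std_normal_distribution)"
    and "\<And>\<omega>. \<omega> \<in> space M \<Longrightarrow>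
      (\<lambda>r. \<chi> i. (real (N r \<omega> i) - lam0 r $ i) / sqrt (lam0 r $ i)) \<longlonglongrightarrow> (\<chi> i. Z \<omega> i)"
proof -
  have "\<forall>i. \<exists>(\<Omega> :: real measure) (N :: nat \<Rightarrow> real \<Rightarrow> nat) (Z :: real \<Rightarrow> real).
    prob_space \<Omega> \<and> (\<forall>r. N r \<in> measurable \<Omega> (count_space UNIV)) \<and>
    (\<forall>r. distr \<Omega> (count_space UNIV) (N r) = measure_pmf (poisson_pmf (lam0 r $ i))) \<and>
    Z \<in> borel_measurable \<Omega> \<and> distr \<Omega> borel Z = std_normal_distribution \<and>
    (\<forall>x\<in>space \<Omega>. (\<lambda>r. (real (N r x) - lam0 r $ i) / sqrt (lam0 r $ i)) \<longlonglongrightarrow> Z x)"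
    by (intro allI poisson_coupling pos lim)
  then obtain \<Omega> :: "'i \<Rightarrow> real measure" and n :: "'i \<Rightarrow> nat \<Rightarrow> real \<Rightarrow> nat" and \<zeta> :: "'i \<Rightarrow> real \<Rightarrow> real"
    where *: "\<forall>i. prob_space (\<Omega> i) \<and> (\<forall>r. n i r \<in> measurable (\<Omega> i) (count_space UNIV)) \<and>
    (\<forall>r. distr (\<Omega> i) (count_space UNIV) (n i r) = measure_pmf (poisson_pmf (lam0 r $ i))) \<and>
    \<zeta> i \<in> borel_measurable (\<Omega> i) \<and> distr (\<Omega> i) borel (\<zeta> i) = std_normal_distribution \<and>
    (\<forall>x\<in>space (\<Omega> i). (\<lambda>r. (real (n i r x) - lam0 r $ i) / sqrt (lam0 r $ i)) \<longlonglongrightarrow> \<zeta> i x)"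
    unfolding choice_iff by blast
  then have \<Omega>: "prob_space (\<Omega> i)"
    and n [measurable]: "n i r \<in> measurable (\<Omega> i) (count_space UNIV)"
    and distr_n: "distr (\<Omega> i) (count_space UNIV) (n i r) = measure_pmf (poisson_pmf (lam0 r $ i))"
    and \<zeta> [measurable]: "\<zeta> i \<in> borel_measurable (\<Omega> i)"
    and distr_\<zeta>: "distr (\<Omega> i) borel (\<zeta> i) = std_normal_distribution"
    and conv: "x \<in> space (\<Omega> i) \<Longrightarrow> (\<lambda>r. (real (n i r x) - lam0 r $ i) / sqrt (lam0 r $ i)) \<longlonglongrightarrow> \<zeta> i x"
    for i r x by blast+
  interpret P: product_prob_space \<Omega> UNIV by (intro product_prob_spaceI \<Omega>)
  define N where "N = (\<lambda>r \<omega> i. n i r (\<omega> i))"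
  have preimage: "N r -` {y} \<inter> space (PiM UNIV \<Omega>) = Pi\<^sub>E UNIV (\<lambda>i. n i r -` {y i} \<inter> space (\<Omega> i))" for r y
    by (auto simp: N_def space_PiM PiE_iff fun_eq_iff)
  have N_meas: "N r \<in> measurable (PiM UNIV \<Omega>) (count_space UNIV)" for r
    by (auto simp: measurable_count_space_eq2_countable preimage intro!: sets_PiM_I_finite)
  \<comment> \<open>Count vectors form a countable space, so singletons suffice, and their preimages
    are boxes.\<close>
  have distr_N: "distr (PiM UNIV \<Omega>) (count_space UNIV) (N r) = measure_pmf (poisson_model (lam0 r))" for r
  proof (rule measure_eqI_countable)
    fix y :: "'i \<Rightarrow> nat"
    have "emeasure (distr (PiM UNIV \<Omega>) (count_space UNIV) (N r)) {y} =
        emeasure (PiM UNIV \<Omega>) (Pi\<^sub>E UNIV (\<lambda>i. n i r -` {y i} \<inter> space (\<Omega> i)))"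
      by (simp add: emeasure_distr[OF N_meas] preimage)
    also have "\<dots> = (\<Prod>i\<in>UNIV. emeasure (\<Omega> i) (n i r -` {y i} \<inter> space (\<Omega> i)))"
      by (rule P.emeasure_PiM) auto
    also have "\<dots> = (\<Prod>i\<in>UNIV. emeasure (distr (\<Omega> i) (count_space UNIV) (n i r)) {y i})"
      by (intro prod.cong refl emeasure_distr[symmetric]) auto
    also have "\<dots> = emeasure (measure_pmf (poisson_model (lam0 r))) {y}"
      by (simp add: distr_n emeasure_pmf_single poisson_model_def pmf_Pi prod_ennreal del: pmf_poisson)
    finally show "emeasure (distr (PiM UNIV \<Omega>) (count_space UNIV) (N r)) {y} =
        emeasure (measure_pmf (poisson_model (lam0 r))) {y}" .
  qed auto
  define Z where "Z = (\<lambda>\<omega> i. \<zeta> i (\<omega> i))"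
  have Z_meas: "Z \<in> measurable (PiM UNIV \<Omega>) (PiM UNIV (\<lambda>_. borel))"
    unfolding Z_def by (rule measurable_PiM_single') (auto simp: space_PiM)
  have distr_Z: "distr (PiM UNIV \<Omega>) (PiM UNIV (\<lambda>_. borel)) Z = PiM UNIV (\<lambda>_. std_normal_distribution)"
    unfolding Z_def using distr_PiM_componentwise[OF \<Omega>, where f = \<zeta> and N = "\<lambda>_. borel"] \<zeta> by (simp add: distr_\<zeta>)
  have conv': "(\<lambda>r. \<chi> i. (real (N r \<omega> i) - lam0 r $ i) / sqrt (lam0 r $ i)) \<longlonglongrightarrow> (\<chi> i. Z \<omega> i)"
    if "\<omega> \<in> space (PiM UNIV \<Omega>)" for \<omega>
    using that by (intro vec_tendstoI) (auto simp: N_def Z_def space_PiM PiE_iff intro!: conv)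
  show thesis
    by (rule that[OF P.prob_space_axioms N_meas distr_N Z_meas distr_Z conv'])
qed

text \<open>An invertible diagonal scaling maps this space onto the kernel of \<open>A\<close>;
  hence the degrees of freedom are the same for every \<open>r\<close>.\<close>

lemma dim_scaled_kernel:
  fixes A :: "real^'i^'j" and s :: "'i \<Rightarrow> real"
  assumes "\<And>i. s i \<noteq> 0"
  shows "subspace {w. A *v (\<chi> i. s i * w $ i) = 0}"
    and "dim {w. A *v (\<chi> i. s i * w $ i) = 0} = dim {x. A *v x = 0}"
proof -
  define f where "f = (\<lambda>w::real^'i. \<chi> i. s i * w $ i)"
  have lin: "linear f"
    unfolding f_def by (rule linearI) (auto simp: vec_eq_iff algebra_simps)
  have inj: "inj f"
    using assms by (auto simp: f_def inj_on_def vec_eq_iff)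
  have surj: "x = f (\<chi> i. x $ i / s i)" for x
    using assms by (simp add: f_def vec_eq_iff)
  have "linear (\<lambda>w. A *v f w)"
    using linear_compose[OF lin matrix_vector_mul_linear[of A]] by (simp add: comp_def)
  then have "subspace {w. A *v f w = 0}"
    by (rule linear_subspace_kernel)
  then show "subspace {w. A *v (\<chi> i. s i * w $ i) = 0}" by (simp add: f_def)
  have "f ` {w. A *v f w = 0} = {x. A *v x = 0}"
  proof (intro equalityI subsetI)
    fix x assume "x \<in> {x. A *v x = 0}"
    then show "x \<in> f ` {w. A *v f w = 0}"
      using surj[of x] by (intro image_eqI[of _ f "\<chi> i. x $ i / s i"]) auto
  qed auto
  moreover have "dim (f ` {w. A *v f w = 0}) = dim {w. A *v f w = 0}"
    by (rule dim_image_eq[OF lin inj_on_subset[OF inj]]) simp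
  ultimately show "dim {w. A *v (\<chi> i. s i * w $ i) = 0} = dim {x. A *v x = 0}"
    by (simp add: f_def)
qed

theorem theorem4p3:
  fixes A :: "real^'i^'j" and lam0 :: "nat \<Rightarrow> real^'i"
  assumes zero_one: "\<forall>j i. A $ j $ i = 0 \<or> A $ j $ i = 1"
    and col_one: "\<forall>i. \<exists>j. A $ j $ i = 1"
    and full_row_rank: "rank A = CARD('j)"
    and in_model: "\<forall>r. lam0 r \<in> RM A"
    and to_infty: "filterlim (\<lambda>r. Min (range (\<lambda>i. lam0 r $ i))) at_top sequentially"
  shows "weak_conv_m
           (\<lambda>r. measure_pmf (map_pmf (\<lambda>Y. pearson (yvec Y) (MLE A Y))
                  (cond_pmf (poisson_model (lam0 r)) (MLE_set A))))
           (chi_squared (dim {x::real^'i. A *v x = 0}))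
       \<and> weak_conv_m
           (\<lambda>r. measure_pmf (map_pmf (\<lambda>Y. bregman (yvec Y) (MLE A Y))
                  (cond_pmf (poisson_model (lam0 r)) (MLE_set A))))
           (chi_squared (dim {x::real^'i. A *v x = 0}))
       \<and> weak_conv_m
           (\<lambda>r. measure_pmf (map_pmf (\<lambda>Y. pearson (yvec Y) (aug_MLE A Y))
                  (poisson_model (lam0 r))))
           (chi_squared (dim {x::real^'i. A *v x = 0}))
       \<and> weak_conv_m
           (\<lambda>r. measure_pmf (map_pmf (\<lambda>Y. bregman (yvec Y) (aug_MLE A Y))
                  (poisson_model (lam0 r))))
           (chi_squared (dim {x::real^'i. A *v x = 0}))"
proof -
  define K where "K = dim {x::real^'i. A *v x = 0}"
  let ?p = "\<lambda>r. poisson_model (lam0 r)" and ?E = "MLE_set A"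
  have pos: "0 < lam0 r $ i" for r i using in_model by (simp add: RM_def)
  have "filterlim (\<lambda>r. lam0 r $ i) at_top sequentially" for i
    by (rule filterlim_at_top_mono[OF to_infty]) (auto intro!: always_eventually)
  then obtain M :: "('i \<Rightarrow> real) measure" and N Z where M: "prob_space M"
    and N [measurable]: "\<And>r. N r \<in> measurable M (count_space UNIV)"
    and distr_N: "\<And>r. distr M (count_space UNIV) (N r) = measure_pmf (?p r)"
    and Z [measurable]: "Z \<in> measurable M (PiM UNIV (\<lambda>_. borel))"
    and distr_Z: "distr M (PiM UNIV (\<lambda>_. borel)) Z = PiM UNIV (\<lambda>_. std_normal_distribution)"
    and conv: "\<And>\<omega>. \<omega> \<in> space M \<Longrightarrow>
      (\<lambda>r. \<chi> i. (real (N r \<omega> i) - lam0 r $ i) / sqrt (lam0 r $ i)) \<longlonglongrightarrow> (\<chi> i. Z \<omega> i)"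
    by (rule poisson_model_coupling[OF pos]) blast
  interpret M: prob_space M by fact

  have "\<forall>r. \<exists>B. finite B \<and> pairwise orthogonal B \<and> (\<forall>b\<in>B. norm b = 1) \<and> card B = K \<and>
      span B = {w. A *v (\<chi> i. sqrt (lam0 r $ i) * w $ i) = 0}"
  proof
    fix r
    have nz: "sqrt (lam0 r $ i) \<noteq> 0" for i using pos[of r i] by simp
    show "\<exists>B. finite B \<and> pairwise orthogonal B \<and> (\<forall>b\<in>B. norm b = 1) \<and> card B = K \<and>
      span B = {w. A *v (\<chi> i. sqrt (lam0 r $ i) * w $ i) = 0}"
    proof (rule orthonormal_basis_subspace[OF dim_scaled_kernel(1)[where s = "\<lambda>i. sqrt (lam0 r $ i)" and A = A, OF nz]])
      fix C assume "pairwise orthogonal C" "\<And>x. x \<in> C \<Longrightarrow> norm x = 1" "independent C"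
        "card C = dim {w. A *v (\<chi> i. sqrt (lam0 r $ i) * w $ i) = 0}"
        "span C = {w. A *v (\<chi> i. sqrt (lam0 r $ i) * w $ i) = 0}"
      then show ?thesis
        unfolding K_def dim_scaled_kernel(2)[where s = "\<lambda>i. sqrt (lam0 r $ i)", OF nz]
        by (intro exI[of _ C]) (simp add: independent_imp_finite)
    qed
  qed
  then obtain B where "\<forall>r. finite (B r) \<and> pairwise orthogonal (B r) \<and> (\<forall>b\<in>B r. norm b = 1) \<and>
      card (B r) = K \<and> span (B r) = {w. A *v (\<chi> i. sqrt (lam0 r $ i) * w $ i) = 0}"
    unfolding choice_iff by blast
  then have B: "\<And>r. finite (B r)" "\<And>r. pairwise orthogonal (B r)" "\<And>r b. b \<in> B r \<Longrightarrow> norm b = 1"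
      "\<And>r. card (B r) = K" "\<And>r. span (B r) = {w. A *v (\<chi> i. sqrt (lam0 r $ i) * w $ i) = 0}"
    by simp_all
  define T where "T = (\<lambda>r \<omega>. \<Sum>b\<in>B r. (b \<bullet> (\<chi> i. Z \<omega> i))\<^sup>2)"
  have T_meas: "T r \<in> borel_measurable M" for r
    unfolding T_def by measurable
  \<comment> \<open>The law depends on the basis only through its size, so it is the same for all
    \<open>r\<close> although \<open>B r\<close> varies.\<close>
  have distr_T: "distr M borel (T r) = chi_squared K" for r
  proof -
    have "distr M borel (T r) =
        distr (distr M (PiM UNIV (\<lambda>_. borel)) Z) borel (\<lambda>x. \<Sum>b\<in>B r. (b \<bullet> (\<chi> i. x i))\<^sup>2)"
      unfolding T_def by (subst distr_distr) (auto simp: comp_def)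
    then show ?thesis
      using distr_orthonormal_sum_squares[OF B(2), of r] B(3)[of _ r] by (simp add: distr_Z B(4))
  qed
  have ev_E: "eventually (\<lambda>r. N r \<omega> \<in> ?E) sequentially"
    and pearson: "(\<lambda>r. pearson (yvec (N r \<omega>)) (MLE A (N r \<omega>)) - T r \<omega>) \<longlonglongrightarrow> 0"
    and bregman: "(\<lambda>r. bregman (yvec (N r \<omega>)) (MLE A (N r \<omega>)) - T r \<omega>) \<longlonglongrightarrow> 0"
    if "\<omega> \<in> space M" for \<omega>
    unfolding T_def
    by (rule statistics_limit[OF in_model[rule_format] to_infty conv[OF that] B(1,2) _ B(4,5)], erule B(3))+

  have weak: "weak_conv_m (\<lambda>r. measure_pmf (map_pmf F (?p r))) (chi_squared K)"
    if F: "\<And>\<omega>. \<omega> \<in> space M \<Longrightarrow> (\<lambda>r. F (N r \<omega>) - T r \<omega>) \<longlonglongrightarrow> 0" for F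
  proof -
    have F_meas: "(\<lambda>\<omega>. F (N r \<omega>)) \<in> borel_measurable M" for r
      by (rule measurable_compose[OF N]) simp
    \<comment> \<open>The two measures have different sigma-algebras, discrete and Borel, but equal
      distribution functions, which are all that weak convergence compares.\<close>
    have "cdf (measure_pmf (map_pmf F (?p r))) x = cdf (distr M borel (\<lambda>\<omega>. F (N r \<omega>))) x" for r x
    proof -
      have "cdf (measure_pmf (map_pmf F (?p r))) x = measure (distr M (count_space UNIV) (N r)) (F -` {..x})"
        by (simp add: cdf_def measure_map_pmf distr_N)
      also have "\<dots> = measure M (N r -` (F -` {..x}) \<inter> space M)"
        by (rule measure_distr[OF N]) simp
      also have "\<dots> = cdf (distr M borel (\<lambda>\<omega>. F (N r \<omega>))) x"
        by (simp add: cdf_def measure_distr[OF F_meas] vimage_def)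
      finally show ?thesis .
    qed
    then show ?thesis
      using weak_conv_m_of_vanishing_difference[OF M F_meas T_meas distr_T F]
      by (simp add: weak_conv_m_def weak_conv_def)
  qed

  have prob_E: "(\<lambda>r. measure_pmf.prob (?p r) ?E) \<longlonglongrightarrow> 1"
  proof -
    \<comment> \<open>At each sample point the indicator is eventually one, so dominated convergence
      applies.\<close>
    have "(\<lambda>r. \<integral>\<omega>. indicator ?E (N r \<omega>) \<partial>M) \<longlonglongrightarrow> (\<integral>\<omega>. 1 \<partial>M :: real)"
    proof (rule integral_dominated_convergence[where w = "\<lambda>_. 1"])
      show "AE \<omega> in M. (\<lambda>r. indicator ?E (N r \<omega>)) \<longlonglongrightarrow> (1::real)"
        by (intro AE_I2 tendsto_eventually) (auto elim: eventually_mono[OF ev_E])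
      show "(\<lambda>\<omega>. indicator ?E (N r \<omega>) :: real) \<in> borel_measurable M" for r
        by (rule measurable_compose[OF N]) simp
    qed auto
    moreover have "(\<integral>\<omega>. indicator ?E (N r \<omega>) \<partial>M) = measure_pmf.prob (?p r) ?E" for r
    proof -
      have "(\<integral>\<omega>. indicator ?E (N r \<omega>) \<partial>M) = (\<integral>y. indicator ?E y \<partial>distr M (count_space UNIV) (N r) :: real)"
        by (subst integral_distr) auto
      then show ?thesis by (simp add: distr_N)
    qed
    ultimately show ?thesis by (simp add: M.prob_space)
  qed
  have ne: "set_pmf (?p r) \<inter> ?E \<noteq> {}" for r
  proof -
    \<comment> \<open>The all-ones count vector has positive probability under every
      \<open>?p r\<close>, and its positive entries guarantee a maximiser.\<close>
    have "(\<lambda>_. 1) \<in> set_pmf (?p r)"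
      using pos by (simp add: set_pmf_iff poisson_model_def pmf_Pi less_imp_neq[symmetric])
    moreover have "(\<lambda>_. 1) \<in> ?E" by (rule MLE_exists) simp
    ultimately show ?thesis by blast
  qed
  \<comment> \<open>At each sample point the counts eventually lie in \<open>?E\<close>, where the
    augmented and the ordinary estimate coincide.\<close>
  have pearson_aug: "(\<lambda>r. pearson (yvec (N r \<omega>)) (aug_MLE A (N r \<omega>)) - T r \<omega>) \<longlonglongrightarrow> 0"
    and bregman_aug: "(\<lambda>r. bregman (yvec (N r \<omega>)) (aug_MLE A (N r \<omega>)) - T r \<omega>) \<longlonglongrightarrow> 0"
    if "\<omega> \<in> space M" for \<omega>
    by (rule Lim_transform_eventually[OF pearson[OF that]] Lim_transform_eventually[OF bregman[OF that]],
        rule eventually_mono[OF ev_E[OF that]], simp add: aug_MLE_def)+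
  show ?thesis
    unfolding K_def[symmetric]
    by (intro conjI weak_conv_m_cond_pmf weak prob_E ne pearson bregman pearson_aug bregman_aug)
qed

end
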